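(* Let $(E,\mathcal{P})$ be a random locally convex module over $K$ with base $(\Omega,\mathcal{F},P)$, $x\in E$, and $M\subset E$ a nonempty $\mathcal{T}_{\varepsilon,\lambda}$-closed $L^0$-convex subset. If $x\notin M$, then there are $f\in E^\ast_c$ and some $B\in\mathcal{F}$ with $P(B)>0$ such that: (1) $(\mathrm{Re} f)(x)>\bigvee\{(\mathrm{Re} f)(y):y\in M\}$ on $B$; (2) $(\mathrm{Re} f)(x)=\bigvee\{(\mathrm{Re} f)(y):y\in M\}$ on $B^c$.
   Context: $(\Omega,\mathcal{F},P)$ is a probability space and $K$ is $\mathbb{R}$ or $\mathbb{C}$. $L^0(\mathcal{F},K)$ is the algebra of equivalence classes (a.s. equality) of $K$-valued $\mathcal{F}$-measurable random variables, $L^0(\mathcal{F})=L^0(\mathcal{F},\mathbb{R})$; $\bar L^0(\mathcal{F})$ is the set of classes of extended real-valued ones, a complete lattice under the a.s. order, with suprema $\bigvee$ and infima $\bigwedge$ taken in it. $L^0_+(\mathcal{F})=\{\xi\in L^0(\mathcal{F}):\xi\ge0\}$, $L^0_{++}(\mathcal{F})=\{\xi\in L^0(\mathcal{F}):\xi>0\text{ a.s.}\}$. For $A\in\mathcal{F}$, "$\xi>\eta$ on $A$" (similarly $=$) means $\xi(\omega)>\eta(\omega)$ for $P$-almost all $\omega\in A$. Random locally convex module over $K$ with base $(\Omega,\mathcal{F},P)$: a pair $(E,\mathcal{P})$ with $E$ an $L^0(\mathcal{F},K)$-module and $\mathcal{P}$ a family of $L^0$-seminorms on $E$ (maps $\|\cdot\|:E\to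 L^0_+(\mathcal{F})$ with $\|\xi x\|=|\xi|\|x\|$ for $\xi\in L^0(\mathcal{F},K)$ and $\|x+y\|\le\|x\|+\|y\|$) such that $\bigvee\{\|x\|:\|\cdot\|\in\mathcal{P}\}=0$ iff $x=\theta$ (null element). $\mathcal{P}_f$ is the family of (nonempty) finite subsets of $\mathcal{P}$, and $\|x\|_{\mathcal{Q}}=\bigvee\{\|x\|:\|\cdot\|\in\mathcal{Q}\}$ for $\mathcal{Q}\in\mathcal{P}_f$. The $(\varepsilon,\lambda)$-topology $\mathcal{T}_{\varepsilon,\lambda}$ on $E$ is the linear topology with local base at $\theta$: $\{x: P(\|x\|_{\mathcal{Q}}<\varepsilon)>1-\lambda\}$, $\mathcal{Q}\in\mathcal{P}_f$, real $\varepsilon>0$, $0<\lambda<1$. The locally $L^0$-convex topology $\mathcal{T}_c$ has local base at $\theta$: $\{x:\|x\|_{\mathcal{Q}}\le\varepsilon\}$, $\mathcal{Q}\in\mathcal{P}_f$, $\varepsilon\in L^0_{++}(\mathcal{F})$; $L^0(\mathcal{F},K)$ carries its own $\mathcal{T}_c$ determined by $|\cdot|$. $E^\ast_c$ is the $L^0(\mathcal{F},K)$-module of continuous module homomorphisms from $(E,\mathcal{T}_c)$ to $(L^0(\mathcal{F},K),\mathcal{T}_c)$. $(\mathrm{Re} f)(x)$ is the real part of $f(x)$. $M\subset E$ is $L^0$-convex if $\xi x+(1-\xi)y\in M$ for all $x,y\in M$ and $\xi\in L^0_+(\mathcal{F})$ with $0\le\xi\le1$. *)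

theory Defs
  imports "HOL-Probability.Probability" "HOL-Algebra.AbelCoset" "HOL-Algebra.Module" "HOL-Algebra.Lattice"
begin

section \<open>Classes of measurable functions modulo almost sure equality\<close>

text \<open>
  \<open>N\<close> is the space of values: \<^term>\<open>borel :: real measure\<close> gives $L^0(\mathcal F)$,
  \<^term>\<open>borel :: ereal measure\<close> gives $\bar L^0(\mathcal F)$, and
  \<^term>\<open>scalars K\<close> below gives $L^0(\mathcal F, K)$.
\<close>

definition ae_rel :: "'w measure \<Rightarrow> 'v measure \<Rightarrow> (('w \<Rightarrow> 'v) \<times> ('w \<Rightarrow> 'v)) set" where
  "ae_rel M N = {(f, g). f \<in> measurable M N \<and> g \<in> measurable M N \<and> (AE \<omega> in M. f \<omega> = g \<omega>)}"

definition L0 :: "'w measure \<Rightarrow> 'v measure \<Rightarrow> ('w \<Rightarrow> 'v) set set" where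
  "L0 M N = measurable M N // ae_rel M N"

definition L0_class :: "'w measure \<Rightarrow> 'v measure \<Rightarrow> ('w \<Rightarrow> 'v) \<Rightarrow> ('w \<Rightarrow> 'v) set" where
  "L0_class M N f = ae_rel M N `` {f}"

text \<open>An arbitrary representative; everything below is independent of the choice.\<close>

definition rep :: "('w \<Rightarrow> 'v) set \<Rightarrow> 'w \<Rightarrow> 'v" where
  "rep X = (SOME f. f \<in> X)"

definition L0_map :: "'w measure \<Rightarrow> 'v measure \<Rightarrow> ('u \<Rightarrow> 'v) \<Rightarrow> ('w \<Rightarrow> 'u) set \<Rightarrow> ('w \<Rightarrow> 'v) set" where
  "L0_map M N h X = L0_class M N (\<lambda>\<omega>. h (rep X \<omega>))"

definition L0_map2 :: "'w measure \<Rightarrow> 'v measure \<Rightarrow> ('u \<Rightarrow> 'u \<Rightarrow> 'v) \<Rightarrow>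
    ('w \<Rightarrow> 'u) set \<Rightarrow> ('w \<Rightarrow> 'u) set \<Rightarrow> ('w \<Rightarrow> 'v) set" where
  "L0_map2 M N h X Y = L0_class M N (\<lambda>\<omega>. h (rep X \<omega>) (rep Y \<omega>))"

definition L0_le :: "'w measure \<Rightarrow> ('w \<Rightarrow> 'v::linorder) set \<Rightarrow> ('w \<Rightarrow> 'v) set \<Rightarrow> bool" where
  "L0_le M X Y \<longleftrightarrow> (AE \<omega> in M. rep X \<omega> \<le> rep Y \<omega>)"

definition gt_on :: "'w measure \<Rightarrow> 'w set \<Rightarrow> ('w \<Rightarrow> 'v::linorder) set \<Rightarrow> ('w \<Rightarrow> 'v) set \<Rightarrow> bool" where
  "gt_on M A X Y \<longleftrightarrow> (AE \<omega> in M. \<omega> \<in> A \<longrightarrow> rep X \<omega> > rep Y \<omega>)"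

definition eq_on :: "'w measure \<Rightarrow> 'w set \<Rightarrow> ('w \<Rightarrow> 'v) set \<Rightarrow> ('w \<Rightarrow> 'v) set \<Rightarrow> bool" where
  "eq_on M A X Y \<longleftrightarrow> (AE \<omega> in M. \<omega> \<in> A \<longrightarrow> rep X \<omega> = rep Y \<omega>)"

abbreviation L0_zero :: "'w measure \<Rightarrow> ('w \<Rightarrow> 'v::{zero, topological_space}) set" where
  "L0_zero M \<equiv> L0_class M borel (\<lambda>_. 0)"

abbreviation L0_one :: "'w measure \<Rightarrow> ('w \<Rightarrow> real) set" where
  "L0_one M \<equiv> L0_class M borel (\<lambda>_. 1)"

definition L0_plus :: "'w measure \<Rightarrow> ('w \<Rightarrow> real) set set" where
  "L0_plus M = {\<xi> \<in> L0 M borel. L0_le M (L0_zero M) \<xi>}"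

definition L0_pplus :: "'w measure \<Rightarrow> ('w \<Rightarrow> real) set set" where
  "L0_pplus M = {\<xi> \<in> L0 M borel. gt_on M (space M) \<xi> (L0_zero M)}"

text \<open>
  The complete lattice $\bar L^0(\mathcal F)$; suprema are taken in it by
  \<^term>\<open>\<Squnion>\<^bsub>L0_bar M\<^esub> A\<close>, after embedding elements of $L^0(\mathcal F)$ by \<open>to_bar\<close>.
\<close>

definition L0_bar :: "'w measure \<Rightarrow> ('w \<Rightarrow> ereal) set gorder" where
  "L0_bar M = \<lparr>carrier = L0 M borel, eq = (=), le = L0_le M\<rparr>"

definition to_bar :: "'w measure \<Rightarrow> ('w \<Rightarrow> real) set \<Rightarrow> ('w \<Rightarrow> ereal) set" where
  "to_bar M = L0_map M borel ereal"


section \<open>The algebra of scalars\<close>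

text \<open>
  The field \<open>K\<close> is given as a set of complex numbers, either \<^term>\<open>\<real>\<close> or \<^term>\<open>UNIV\<close>.
\<close>

abbreviation scalars :: "complex set \<Rightarrow> complex measure" where
  "scalars K \<equiv> restrict_space borel K"

definition L0_ring :: "'w measure \<Rightarrow> complex set \<Rightarrow> ('w \<Rightarrow> complex) set ring" where
  "L0_ring M K = \<lparr>carrier = L0 M (scalars K),
     mult = L0_map2 M (scalars K) (*), one = L0_class M (scalars K) (\<lambda>_. 1),
     zero = L0_class M (scalars K) (\<lambda>_. 0), add = L0_map2 M (scalars K) (+)\<rparr>"

definition L0_abs :: "'w measure \<Rightarrow> ('w \<Rightarrow> complex) set \<Rightarrow> ('w \<Rightarrow> real) set" where
  "L0_abs M = L0_map M borel cmod"

definition L0_Re :: "'w measure \<Rightarrow> ('w \<Rightarrow> complex) set \<Rightarrow> ('w \<Rightarrow> real) set" where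
  "L0_Re M = L0_map M borel Re"

definition L0_of_real :: "'w measure \<Rightarrow> complex set \<Rightarrow> ('w \<Rightarrow> real) set \<Rightarrow> ('w \<Rightarrow> complex) set" where
  "L0_of_real M K = L0_map M (scalars K) complex_of_real"


section \<open>Random locally convex modules\<close>

definition L0_seminorm :: "'w measure \<Rightarrow> complex set \<Rightarrow> (('w \<Rightarrow> complex) set, 'e, 'm) module_scheme \<Rightarrow>
    ('e \<Rightarrow> ('w \<Rightarrow> real) set) \<Rightarrow> bool" where
  "L0_seminorm M K E p \<longleftrightarrow>
     p \<in> carrier E \<rightarrow> L0_plus M \<and>
     (\<forall>\<xi>\<in>carrier (L0_ring M K). \<forall>x\<in>carrier E.
        p (\<xi> \<odot>\<^bsub>E\<^esub> x) = L0_map2 M borel (*) (L0_abs M \<xi>) (p x)) \<and>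
     (\<forall>x\<in>carrier E. \<forall>y\<in>carrier E.
        L0_le M (p (x \<oplus>\<^bsub>E\<^esub> y)) (L0_map2 M borel (+) (p x) (p y)))"

definition sup_norm :: "'w measure \<Rightarrow> ('e \<Rightarrow> ('w \<Rightarrow> real) set) set \<Rightarrow> 'e \<Rightarrow> ('w \<Rightarrow> ereal) set" where
  "sup_norm M Q x = \<Squnion>\<^bsub>L0_bar M\<^esub> ((\<lambda>p. to_bar M (p x)) ` Q)"

text \<open>
  In \<open>separating\<close> the supremum of the empty family is the class of \<^term>\<open>-\<infinity> :: ereal\<close>, so
  \<open>\<P>\<close> is automatically nonempty.
\<close>

locale random_locally_convex_module =
  prob_space M + Module.module "L0_ring M K" E
  for M :: "'w measure" and K :: "complex set"
    and E :: "(('w \<Rightarrow> complex) set, 'e, 'm) module_scheme"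
    and \<P> :: "('e \<Rightarrow> ('w \<Rightarrow> real) set) set" +
  assumes scalar_field: "K = \<real> \<or> K = UNIV"
    and seminorms: "p \<in> \<P> \<Longrightarrow> L0_seminorm M K E p"
    and separating: "x \<in> carrier E \<Longrightarrow> sup_norm M \<P> x = L0_zero M \<longleftrightarrow> x = \<zero>\<^bsub>E\<^esub>"

definition finite_subfamilies :: "'p set \<Rightarrow> 'p set set" where
  "finite_subfamilies \<P> = {Q. Q \<subseteq> \<P> \<and> finite Q \<and> Q \<noteq> {}}"

text \<open>The translation invariant topology on an additive group with local base \<open>\<B>\<close> at zero.\<close>

definition local_base_topology :: "('e, 'm) ring_scheme \<Rightarrow> 'e set set \<Rightarrow> 'e topology" where
  "local_base_topology G \<B> =
     topology (\<lambda>U. U \<subseteq> carrier G \<and> (\<forall>x\<in>U. \<exists>V\<in>\<B>. x <+\<^bsub>G\<^esub> V \<subseteq> U))"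

lemma openin_local_base_topology:
  assumes "\<B> \<noteq> {}" and "\<And>V W. V \<in> \<B> \<Longrightarrow> W \<in> \<B> \<Longrightarrow> \<exists>U\<in>\<B>. U \<subseteq> V \<inter> W"
  shows "openin (local_base_topology G \<B>) U \<longleftrightarrow>
    U \<subseteq> carrier G \<and> (\<forall>x\<in>U. \<exists>V\<in>\<B>. x <+\<^bsub>G\<^esub> V \<subseteq> U)"
proof -
  have mono: "x <+\<^bsub>G\<^esub> V \<subseteq> x <+\<^bsub>G\<^esub> W" if "V \<subseteq> W" for x V W
    using that by (auto simp: a_l_coset_def')
  have "istopology (\<lambda>U. U \<subseteq> carrier G \<and> (\<forall>x\<in>U. \<exists>V\<in>\<B>. x <+\<^bsub>G\<^esub> V \<subseteq> U))"
    unfolding istopology_def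
  proof (intro conjI allI impI ballI)
    fix S T x
    assume S: "S \<subseteq> carrier G \<and> (\<forall>x\<in>S. \<exists>V\<in>\<B>. x <+\<^bsub>G\<^esub> V \<subseteq> S)"
      and T: "T \<subseteq> carrier G \<and> (\<forall>x\<in>T. \<exists>V\<in>\<B>. x <+\<^bsub>G\<^esub> V \<subseteq> T)"
    then show "S \<inter> T \<subseteq> carrier G" by blast
    assume "x \<in> S \<inter> T"
    then obtain V W where "V \<in> \<B>" "W \<in> \<B>" "x <+\<^bsub>G\<^esub> V \<subseteq> S" "x <+\<^bsub>G\<^esub> W \<subseteq> T"
      using S T by blast
    moreover from this obtain U where "U \<in> \<B>" "U \<subseteq> V \<inter> W" using assms(2) by blast
    ultimately show "\<exists>V\<in>\<B>. x <+\<^bsub>G\<^esub> V \<subseteq> S \<inter> T"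
      using mono[of U V x] mono[of U W x] by blast
  next
    fix \<K> :: "'a set set"
    assume *: "\<forall>U\<in>\<K>. U \<subseteq> carrier G \<and> (\<forall>x\<in>U. \<exists>V\<in>\<B>. x <+\<^bsub>G\<^esub> V \<subseteq> U)"
    then show "\<Union>\<K> \<subseteq> carrier G" by blast
    fix x assume "x \<in> \<Union>\<K>"
    then obtain U where "U \<in> \<K>" "x \<in> U" by blast
    with * obtain V where "V \<in> \<B>" "x <+\<^bsub>G\<^esub> V \<subseteq> U" by blast
    with \<open>U \<in> \<K>\<close> show "\<exists>V\<in>\<B>. x <+\<^bsub>G\<^esub> V \<subseteq> \<Union>\<K>" by blast
  qed
  then show ?thesis
    by (simp add: local_base_topology_def topology_inverse')
qed

definition eps_lambda_topology :: "'w measure \<Rightarrow> ('e, 'm) ring_scheme \<Rightarrow>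
    ('e \<Rightarrow> ('w \<Rightarrow> real) set) set \<Rightarrow> 'e topology" where
  "eps_lambda_topology M E \<P> = local_base_topology E
     {{x \<in> carrier E. measure M {\<omega> \<in> space M. rep (sup_norm M Q x) \<omega> < ereal \<epsilon>} > 1 - \<delta>} | Q \<epsilon> \<delta>.
       Q \<in> finite_subfamilies \<P> \<and> 0 < \<epsilon> \<and> 0 < \<delta> \<and> \<delta> < 1}"

definition L0_convex_topology :: "'w measure \<Rightarrow> ('e, 'm) ring_scheme \<Rightarrow>
    ('e \<Rightarrow> ('w \<Rightarrow> real) set) set \<Rightarrow> 'e topology" where
  "L0_convex_topology M E \<P> = local_base_topology E
     {{x \<in> carrier E. L0_le M (sup_norm M Q x) (to_bar M \<epsilon>)} | Q \<epsilon>.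
       Q \<in> finite_subfamilies \<P> \<and> \<epsilon> \<in> L0_pplus M}"

text \<open>$E^*_c$; the scalars are topologised by the single $L^0$-seminorm $|\cdot|$.\<close>

definition dual_c :: "'w measure \<Rightarrow> complex set \<Rightarrow> (('w \<Rightarrow> complex) set, 'e, 'm) module_scheme \<Rightarrow>
    ('e \<Rightarrow> ('w \<Rightarrow> real) set) set \<Rightarrow> ('e \<Rightarrow> ('w \<Rightarrow> complex) set) set" where
  "dual_c M K E \<P> = {f \<in> carrier E \<rightarrow> carrier (L0_ring M K).
     (\<forall>x\<in>carrier E. \<forall>y\<in>carrier E. f (x \<oplus>\<^bsub>E\<^esub> y) = f x \<oplus>\<^bsub>L0_ring M K\<^esub> f y) \<and>
     (\<forall>\<xi>\<in>carrier (L0_ring M K). \<forall>x\<in>carrier E. f (\<xi> \<odot>\<^bsub>E\<^esub> x) = \<xi> \<otimes>\<^bsub>L0_ring M K\<^esub> f x) \<and>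
     continuous_map (L0_convex_topology M E \<P>)
       (L0_convex_topology M (L0_ring M K) {L0_abs M}) f}"

definition L0_convex :: "'w measure \<Rightarrow> complex set \<Rightarrow> (('w \<Rightarrow> complex) set, 'e, 'm) module_scheme \<Rightarrow>
    'e set \<Rightarrow> bool" where
  "L0_convex M K E C \<longleftrightarrow>
     (\<forall>x\<in>C. \<forall>y\<in>C. \<forall>\<xi>\<in>L0_plus M. L0_le M \<xi> (L0_one M) \<longrightarrow>
        (L0_of_real M K \<xi> \<odot>\<^bsub>E\<^esub> x) \<oplus>\<^bsub>E\<^esub>
        ((\<one>\<^bsub>L0_ring M K\<^esub> \<ominus>\<^bsub>L0_ring M K\<^esub> L0_of_real M K \<xi>) \<odot>\<^bsub>E\<^esub> y) \<in> C)"

end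

theory Submission
  imports Defs
begin

text \<open>
  Since \<open>C\<close> is closed and indicator functions allow points of \<open>C\<close> to be glued, some finite family of
  seminorms with maximum \<open>p\<close>, a real \<open>\<epsilon> > 0\<close> and an event \<open>B\<close> of positive probability satisfy
  \<open>p (x - y) \<ge> \<epsilon>\<close> on \<open>B\<close> for all \<open>y \<in> C\<close>. A Mazur--Orlicz form of the Hahn--Banach theorem over the
  measurable functions, with infima replaced by essential infima and the linear functional found as a
  minimal sublinear one, yields a linear \<open>f \<le> p\<close> with \<open>f (x - y) \<ge> \<epsilon> 1\<^sub>B\<close> for all \<open>y \<in> C\<close>. The
  functional sought has real part \<open>1\<^sub>B f\<close>.
\<close>

text \<open>Extending a functional from a submodule by one element \<open>z\<close> is awkward here:
  nonzero scalars may be zero divisors, so \<open>\<xi> z\<close> can fall into the submodule for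
  nonzero \<open>\<xi>\<close>, and the value at \<open>z\<close> is then already prescribed on part
  of the probability space. Minimising among sublinear functionals defined on all of
  \<open>E\<close> avoids submodules altogether. A second obstacle is that all relations hold almost
  everywhere: exceptional null sets cannot be united over an uncountable family, and pointwise
  infima of such families need not be measurable. Countable subfamilies found by exhaustion resolve
  both. The constant \<open>\<epsilon>\<close> matters because a strict inequality valid for each
  \<open>y\<close> separately could be lost in the supremum over \<open>C\<close>, while a gap
  independent of \<open>y\<close> survives. Off \<open>B\<close> only
  \<open>f (x - y) \<ge> 0\<close> is known, so \<open>f x\<close> may exceed the supremum there
  too; the indicator factor makes both sides 0 off \<open>B\<close> and gives the equality
  (2).\<close>

section \<open>Essential infima\<close>

text \<open>Exhaustion: countable subfamilies whose unions have measures tending to the supremum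
  \<open>s\<close> combine into one whose union attains \<open>s\<close>. Adding a further
  \<open>A\<close> cannot raise the measure, so the part of \<open>A\<close> outside the union is
  null.\<close>

lemma (in finite_measure) countable_essential_union:
  assumes "\<A> \<subseteq> sets M"
  shows "\<exists>\<S>\<subseteq>\<A>. countable \<S> \<and> (\<forall>A\<in>\<A>. AE \<omega> in M. \<omega> \<in> A \<longrightarrow> \<omega> \<in> \<Union>\<S>)"
proof -
  define F where "F = {\<S>. \<S> \<subseteq> \<A> \<and> countable \<S>}"
  define s where "s = (SUP \<S>\<in>F. measure M (\<Union>\<S>))"
  have ne: "F \<noteq> {}" by (auto simp: F_def)
  have bdd: "bdd_above ((\<lambda>\<S>. measure M (\<Union>\<S>)) ` F)"
    by (intro bdd_aboveI2[where M = "measure M (space M)"] bounded_measure)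
  have le_s: "measure M (\<Union>\<S>) \<le> s" if "\<S> \<in> F" for \<S>
    unfolding s_def using that bdd by (rule cSUP_upper)
  have sets: "\<Union>\<S> \<in> sets M" if "\<S> \<in> F" for \<S>
    using that assms by (auto simp: F_def intro!: sets.countable_Union)
  have "\<exists>\<S>\<in>F. s - 1 / Suc n < measure M (\<Union>\<S>)" for n
    using less_cSUP_iff[OF ne bdd, of "s - 1 / Suc n"] by (simp add: s_def)
  then obtain T where T: "\<And>n. T n \<in> F" "\<And>n. s - 1 / Suc n < measure M (\<Union>(T n))"
    by metis
  define \<S> where "\<S> = (\<Union>n. T n)"
  have SF: "\<S> \<in> F" using T(1) by (auto simp: F_def \<S>_def)
  have "s - 1 / Suc n \<le> measure M (\<Union>\<S>)" for n
  proof -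
    have "measure M (\<Union>(T n)) \<le> measure M (\<Union>\<S>)"
      by (rule finite_measure_mono[OF _ sets[OF SF]]) (auto simp: \<S>_def)
    then show ?thesis using T(2)[of n] by linarith
  qed
  moreover have "(\<lambda>n. s - 1 / Suc n) \<longlonglongrightarrow> s - 0"
    by (intro tendsto_intros LIMSEQ_Suc[OF lim_1_over_n])
  ultimately have s: "s \<le> measure M (\<Union>\<S>)"
    by (intro LIMSEQ_le_const2[of _ s]) auto
  have "AE \<omega> in M. \<omega> \<in> A \<longrightarrow> \<omega> \<in> \<Union>\<S>" if A: "A \<in> \<A>" for A
  proof -
    have ins: "insert A \<S> \<in> F" using SF A by (auto simp: F_def)
    have Am: "A \<in> sets M" using A assms by auto
    have "measure M (\<Union>(insert A \<S>)) = measure M (\<Union>\<S>) + measure M (A - \<Union>\<S>)"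
      using finite_measure_Union'[OF sets[OF SF] Am] by (simp add: Un_commute)
    then have "measure M (A - \<Union>\<S>) = 0"
      using le_s[OF ins] s measure_nonneg[of M "A - \<Union>\<S>"] by linarith
    then have "A - \<Union>\<S> \<in> null_sets M"
      using Am sets[OF SF] by (simp add: null_sets_def emeasure_eq_measure)
    then show ?thesis by (rule AE_I') auto
  qed
  then show ?thesis using SF by (auto simp: F_def)
qed

text \<open>The countable essential union is the increasing limit of finite unions
  \<open>R n\<close>. By directedness each \<open>R n\<close> lies almost everywhere in a single
  member and so has measure at most \<open>c\<close>; continuity from below carries the bound to the
  limit. The sign of \<open>c\<close> settles the case of an empty subfamily.\<close>

lemma (in finite_measure) directed_essential_union:
  assumes \<A>: "\<A> \<subseteq> sets M"
    and directed: "\<And>A B. A \<in> \<A> \<Longrightarrow> B \<in> \<A> \<Longrightarrow> \<exists>C\<in>\<A>. AE \<omega> in M. \<omega> \<in> A \<union> B \<longrightarrow> \<omega> \<in> C"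
    and bound: "\<And>A. A \<in> \<A> \<Longrightarrow> measure M A \<le> c" and "0 \<le> c"
  shows "\<exists>U\<in>sets M. measure M U \<le> c \<and> (\<forall>A\<in>\<A>. AE \<omega> in M. \<omega> \<in> A \<longrightarrow> \<omega> \<in> U)"
proof -
  obtain \<S> where \<S>: "\<S> \<subseteq> \<A>" "countable \<S>" "\<forall>A\<in>\<A>. AE \<omega> in M. \<omega> \<in> A \<longrightarrow> \<omega> \<in> \<Union>\<S>"
    using countable_essential_union[OF \<A>] by blast
  have Um: "\<Union>\<S> \<in> sets M" using \<S> \<A> by (intro sets.countable_Union) auto
  have "measure M (\<Union>\<S>) \<le> c"
  proof (cases "\<S> = {}")
    case True
    then show ?thesis using \<open>0 \<le> c\<close> by simp
  next
    case False
    define S where "S = from_nat_into \<S>"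
    have S: "\<S> = range S"
      unfolding S_def by (rule range_from_nat_into[OF False \<S>(2), symmetric])
    have SA: "S n \<in> \<A>" for n using \<S>(1) S by auto
    define R where "R n = (\<Union>i\<le>n. S i)" for n
    have Rm: "R n \<in> sets M" for n
      unfolding R_def using SA \<A> by (intro sets.finite_UN) auto
    have "\<exists>C\<in>\<A>. AE \<omega> in M. \<omega> \<in> R n \<longrightarrow> \<omega> \<in> C" for n
    proof (induction n)
      case 0
      show ?case using SA[of 0] by (intro bexI[of _ "S 0"]) (simp_all add: R_def)
    next
      case (Suc n)
      then obtain C where C: "C \<in> \<A>" "AE \<omega> in M. \<omega> \<in> R n \<longrightarrow> \<omega> \<in> C" by blast
      obtain D where D: "D \<in> \<A>" "AE \<omega> in M. \<omega> \<in> C \<union> S (Suc n) \<longrightarrow> \<omega> \<in> D"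
        using directed[OF C(1) SA[of "Suc n"]] by blast
      have R_Suc: "R (Suc n) = R n \<union> S (Suc n)" by (auto simp: R_def atMost_Suc)
      from C(2) D(2) have "AE \<omega> in M. \<omega> \<in> R (Suc n) \<longrightarrow> \<omega> \<in> D"
        by eventually_elim (auto simp: R_Suc)
      with D(1) show ?case by blast
    qed
    then have Rc: "measure M (R n) \<le> c" for n
    proof -
      obtain C where C: "C \<in> \<A>" "AE \<omega> in M. \<omega> \<in> R n \<longrightarrow> \<omega> \<in> C"
        using \<open>\<exists>C\<in>\<A>. AE \<omega> in M. \<omega> \<in> R n \<longrightarrow> \<omega> \<in> C\<close> by blast
      have "measure M (R n) \<le> measure M C"
        by (rule finite_measure_mono_AE) (use C \<A> in auto)
      also have "\<dots> \<le> c" by (rule bound[OF C(1)])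
      finally show ?thesis .
    qed
    have "(\<lambda>n. measure M (R n)) \<longlonglongrightarrow> measure M (\<Union>n. R n)"
    proof (rule finite_Lim_measure_incseq)
      show "range R \<subseteq> sets M" using Rm by blast
      show "incseq R" unfolding R_def by (intro monoI UN_mono) auto
    qed
    moreover have "(\<Union>n. R n) = \<Union>\<S>" by (auto simp: R_def S)
    ultimately show ?thesis
      using Rc by (intro LIMSEQ_le_const2[of "\<lambda>n. measure M (R n)"]) auto
  qed
  with \<S>(3) Um show ?thesis by blast
qed

text \<open>Exhaustion is applied to the strict sublevel sets of each rational level, and the
  countably many subfamilies are united. If the infimum exceeded \<open>g\<close> at a point, a
  rational strictly between would place the point in a sublevel set of \<open>g\<close> but in none
  of the chosen functions.\<close>

lemma (in finite_measure) countable_essential_INF: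
  fixes G :: "('a \<Rightarrow> ereal) set"
  assumes "G \<subseteq> borel_measurable M"
  shows "\<exists>S\<subseteq>G. countable S \<and> (\<forall>g\<in>G. AE \<omega> in M. (INF s\<in>S. s \<omega>) \<le> g \<omega>)"
proof -
  define lev where "lev r g = {\<omega> \<in> space M. g \<omega> < ereal (real_of_rat r)}" for r and g :: "'a \<Rightarrow> ereal"
  have "\<exists>S. S \<subseteq> G \<and> countable S \<and>
      (\<forall>g\<in>G. AE \<omega> in M. \<omega> \<in> lev r g \<longrightarrow> \<omega> \<in> \<Union>(lev r ` S))" for r
  proof -
    have "lev r ` G \<subseteq> sets M"
      using assms by (auto simp: lev_def)
    from countable_essential_union[OF this]
    obtain \<S> where \<S>: "\<S> \<subseteq> lev r ` G" "countable \<S>"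
      "\<forall>A\<in>lev r ` G. AE \<omega> in M. \<omega> \<in> A \<longrightarrow> \<omega> \<in> \<Union>\<S>"
      by blast
    have "\<exists>S. countable S \<and> S \<subseteq> G \<and> \<S> = lev r ` S"
      using \<S>(1,2) by (simp add: countable_subset_image[symmetric])
    then obtain S where S: "countable S" "S \<subseteq> G" "\<S> = lev r ` S"
      by blast
    show ?thesis
      by (rule exI[of _ S]) (use \<S>(3) S in simp)
  qed
  then obtain T where T: "\<And>r. T r \<subseteq> G" "\<And>r. countable (T r)"
    "\<And>r g. g \<in> G \<Longrightarrow> AE \<omega> in M. \<omega> \<in> lev r g \<longrightarrow> \<omega> \<in> \<Union>(lev r ` T r)"
    by metis
  show ?thesis
  proof (intro exI[of _ "\<Union>r. T r"] conjI ballI)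
    show "(\<Union>r. T r) \<subseteq> G" "countable (\<Union>r. T r)" using T by auto
    fix g assume "g \<in> G"
    then have "AE \<omega> in M. \<forall>r. \<omega> \<in> lev r g \<longrightarrow> \<omega> \<in> \<Union>(lev r ` T r)"
      using T(3) by (simp add: AE_all_countable)
    moreover have "AE \<omega> in M. \<omega> \<in> space M" by simp
    ultimately show "AE \<omega> in M. (INF s\<in>\<Union>r. T r. s \<omega>) \<le> g \<omega>"
    proof eventually_elim
      case (elim \<omega>)
      show ?case
      proof (rule ccontr)
        assume "\<not> ?thesis"
        then obtain r where r: "g \<omega> < ereal (real_of_rat r)"
            "ereal (real_of_rat r) < (INF s\<in>\<Union>r. T r. s \<omega>)"
          using ereal_dense3 by (metis not_le)
        then obtain s where "s \<in> T r" "s \<omega> < ereal (real_of_rat r)"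
          using elim by (auto simp: lev_def)
        moreover from this have "(INF s\<in>\<Union>r. T r. s \<omega>) \<le> s \<omega>"
          by (intro INF_lower) auto
        ultimately show False using r by auto
      qed
    qed
  qed
qed

text \<open>The countable infimum is formed in \<open>ereal\<close>, where it always exists; the
  lower bound \<open>l\<close> and any one member of \<open>G\<close> make it finite almost
  everywhere. Maximality holds against arbitrary functions \<open>k\<close>, so later test functions
  come without a measurability proof.\<close>

lemma (in finite_measure) essential_infimum_real:
  fixes G :: "('a \<Rightarrow> real) set"
  assumes "G \<noteq> {}" "G \<subseteq> borel_measurable M" and lower: "\<And>g. g \<in> G \<Longrightarrow> AE \<omega> in M. l \<omega> \<le> g \<omega>"
  shows "\<exists>h. h \<in> borel_measurable M \<and> (\<forall>g\<in>G. AE \<omega> in M. h \<omega> \<le> g \<omega>) \<and>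
    (\<forall>k. (\<forall>g\<in>G. AE \<omega> in M. k \<omega> \<le> g \<omega>) \<longrightarrow> (AE \<omega> in M. k \<omega> \<le> h \<omega>))"
proof -
  have "(\<lambda>g \<omega>. ereal (g \<omega>)) ` G \<subseteq> borel_measurable M"
    using assms(2) by auto
  from countable_essential_INF[OF this]
  obtain T where T: "T \<subseteq> (\<lambda>g \<omega>. ereal (g \<omega>)) ` G" "countable T"
    "\<forall>g\<in>(\<lambda>g \<omega>. ereal (g \<omega>)) ` G. AE \<omega> in M. (INF s\<in>T. s \<omega>) \<le> g \<omega>"
    by blast
  obtain S where S: "countable S" "S \<subseteq> G" and TS: "T = (\<lambda>g \<omega>. ereal (g \<omega>)) ` S"
    using T(1,2) by (metis countable_subset_image)
  define I where "I \<omega> = (INF s\<in>S. ereal (s \<omega>))" for \<omega>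
  have I_le: "AE \<omega> in M. I \<omega> \<le> ereal (g \<omega>)" if "g \<in> G" for g
    using T(3)[rule_format, of "\<lambda>\<omega>. ereal (g \<omega>)"] that by (auto simp: TS I_def image_image)
  have le_I: "AE \<omega> in M. ereal (k \<omega>) \<le> I \<omega>" if "\<And>g. g \<in> G \<Longrightarrow> AE \<omega> in M. k \<omega> \<le> g \<omega>" for k
  proof -
    have "AE \<omega> in M. \<forall>s\<in>S. k \<omega> \<le> s \<omega>"
      using S that by (subst AE_ball_countable) auto
    then show ?thesis by eventually_elim (auto simp: I_def intro!: INF_greatest)
  qed
  have Im: "I \<in> borel_measurable M"
    unfolding I_def using S assms(2) by (intro borel_measurable_INF) auto
  obtain g0 where "g0 \<in> G" using assms(1) by auto
  have "AE \<omega> in M. ereal (l \<omega>) \<le> I \<omega>"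
    by (rule le_I) (rule lower)
  with I_le[OF \<open>g0 \<in> G\<close>] have fin: "AE \<omega> in M. ereal (real_of_ereal (I \<omega>)) = I \<omega>"
  proof eventually_elim
    case (elim \<omega>)
    then have "\<bar>I \<omega>\<bar> \<noteq> \<infinity>" by (cases "I \<omega>") auto
    then show ?case by (rule ereal_real')
  qed
  show ?thesis
  proof (intro exI[of _ "\<lambda>\<omega>. real_of_ereal (I \<omega>)"] conjI ballI allI impI)
    show "(\<lambda>\<omega>. real_of_ereal (I \<omega>)) \<in> borel_measurable M" using Im by simp
    show "AE \<omega> in M. real_of_ereal (I \<omega>) \<le> g \<omega>" if "g \<in> G" for g
      using I_le[OF that] fin by eventually_elim (metis ereal_less_eq(3))
    show "AE \<omega> in M. k \<omega> \<le> real_of_ereal (I \<omega>)"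
      if k: "\<forall>g\<in>G. AE \<omega> in M. k \<omega> \<le> g \<omega>" for k
    proof -
      have "AE \<omega> in M. ereal (k \<omega>) \<le> I \<omega>"
        by (rule le_I) (use k in blast)
      with fin show ?thesis by eventually_elim (metis ereal_less_eq(3))
    qed
  qed
qed

section \<open>The Hahn--Banach theorem over the measurable functions\<close>

text \<open>The Hahn-Banach argument uses real scalars alone, and is therefore carried out for
  functions, not classes, acting on an abelian group. Pointwise constructions such as quotients,
  indicators and positive parts are then available as scalars, and both choices of \<open>K\<close>
  can be served by restricting to real scalars.\<close>

locale real_function_module = prob_space M + abelian_group E
  for M :: "'w measure" and E :: "('e, 'm) ring_scheme" +
  fixes act :: "('w \<Rightarrow> real) \<Rightarrow> 'e \<Rightarrow> 'e"
  assumes act_closed: "a \<in> borel_measurable M \<Longrightarrow> z \<in> carrier E \<Longrightarrow> act a z \<in> carrier E"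
    and act_add: "a \<in> borel_measurable M \<Longrightarrow> z \<in> carrier E \<Longrightarrow> w \<in> carrier E \<Longrightarrow>
      act a (z \<oplus>\<^bsub>E\<^esub> w) = act a z \<oplus>\<^bsub>E\<^esub> act a w"
    and act_plus: "a \<in> borel_measurable M \<Longrightarrow> b \<in> borel_measurable M \<Longrightarrow> z \<in> carrier E \<Longrightarrow>
      act (\<lambda>\<omega>. a \<omega> + b \<omega>) z = act a z \<oplus>\<^bsub>E\<^esub> act b z"
    and act_times: "a \<in> borel_measurable M \<Longrightarrow> b \<in> borel_measurable M \<Longrightarrow> z \<in> carrier E \<Longrightarrow>
      act (\<lambda>\<omega>. a \<omega> * b \<omega>) z = act a (act b z)"
    and act_one: "z \<in> carrier E \<Longrightarrow> act (\<lambda>_. 1) z = z"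
begin

lemma act_zero: "z \<in> carrier E \<Longrightarrow> act (\<lambda>_. 0) z = \<zero>\<^bsub>E\<^esub>"
  using act_plus[of "\<lambda>_. 0" "\<lambda>_. 0" z] act_closed[of "\<lambda>_. 0" z] by (simp add: add.l_cancel_one)

lemma act_minus_one: "z \<in> carrier E \<Longrightarrow> act (\<lambda>_. - 1) z = \<ominus>\<^bsub>E\<^esub> z"
  using act_plus[of "\<lambda>_. - 1" "\<lambda>_. 1" z] act_closed[of "\<lambda>_. - 1" z]
  by (intro sym[OF minus_equality]) (auto simp: act_zero act_one)

text \<open>Homogeneity is stated as an inequality because this is what an essential infimum
  inherits directly; \<open>sublinear_act\<close> upgrades it to equality.\<close>

definition sublinear :: "('e \<Rightarrow> 'w \<Rightarrow> real) \<Rightarrow> bool" where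
  "sublinear q \<longleftrightarrow> (\<forall>z\<in>carrier E. q z \<in> borel_measurable M) \<and>
    (\<forall>z\<in>carrier E. \<forall>w\<in>carrier E. AE \<omega> in M. q (z \<oplus>\<^bsub>E\<^esub> w) \<omega> \<le> q z \<omega> + q w \<omega>) \<and>
    (\<forall>a\<in>borel_measurable M. \<forall>z\<in>carrier E. (\<forall>\<omega>. 0 \<le> a \<omega>) \<longrightarrow>
      (AE \<omega> in M. q (act a z) \<omega> \<le> a \<omega> * q z \<omega>))"

definition linear :: "('e \<Rightarrow> 'w \<Rightarrow> real) \<Rightarrow> bool" where
  "linear f \<longleftrightarrow> (\<forall>z\<in>carrier E. f z \<in> borel_measurable M) \<and>
    (\<forall>z\<in>carrier E. \<forall>w\<in>carrier E. AE \<omega> in M. f (z \<oplus>\<^bsub>E\<^esub> w) \<omega> = f z \<omega> + f w \<omega>) \<and>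
    (\<forall>a\<in>borel_measurable M. \<forall>z\<in>carrier E. AE \<omega> in M. f (act a z) \<omega> = a \<omega> * f z \<omega>)"

definition dominated :: "('e \<Rightarrow> 'w \<Rightarrow> real) \<Rightarrow> ('e \<Rightarrow> 'w \<Rightarrow> real) \<Rightarrow> bool" where
  "dominated q p \<longleftrightarrow> (\<forall>z\<in>carrier E. AE \<omega> in M. q z \<omega> \<le> p z \<omega>)"

lemma dominated_trans: "dominated q p \<Longrightarrow> dominated p r \<Longrightarrow> dominated q r"
  unfolding dominated_def
proof
  fix z assume *: "\<forall>z\<in>carrier E. AE \<omega> in M. q z \<omega> \<le> p z \<omega>"
    "\<forall>z\<in>carrier E. AE \<omega> in M. p z \<omega> \<le> r z \<omega>" "z \<in> carrier E"
  then have "AE \<omega> in M. q z \<omega> \<le> p z \<omega>" "AE \<omega> in M. p z \<omega> \<le> r z \<omega>" by auto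
  then show "AE \<omega> in M. q z \<omega> \<le> r z \<omega>" by eventually_elim simp
qed

section \<open>Elementary properties of sublinear functionals\<close>

lemma sublinearD:
  assumes "sublinear q" "z \<in> carrier E"
  shows sublinear_measurable: "q z \<in> borel_measurable M"
    and sublinear_add: "w \<in> carrier E \<Longrightarrow> AE \<omega> in M. q (z \<oplus>\<^bsub>E\<^esub> w) \<omega> \<le> q z \<omega> + q w \<omega>"
    and sublinear_act_le: "a \<in> borel_measurable M \<Longrightarrow> (\<And>\<omega>. 0 \<le> a \<omega>) \<Longrightarrow>
      AE \<omega> in M. q (act a z) \<omega> \<le> a \<omega> * q z \<omega>"
  using assms by (auto simp: sublinear_def)

lemma sublinear_zero:
  assumes "sublinear q"
  shows "AE \<omega> in M. q \<zero>\<^bsub>E\<^esub> \<omega> = 0"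
proof -
  have "AE \<omega> in M. q \<zero>\<^bsub>E\<^esub> \<omega> \<le> q \<zero>\<^bsub>E\<^esub> \<omega> + q \<zero>\<^bsub>E\<^esub> \<omega>"
    using sublinear_add[OF assms, of "\<zero>\<^bsub>E\<^esub>" "\<zero>\<^bsub>E\<^esub>"] by simp
  moreover have "AE \<omega> in M. q \<zero>\<^bsub>E\<^esub> \<omega> \<le> 0"
    using sublinear_act_le[OF assms, of "\<zero>\<^bsub>E\<^esub>" "\<lambda>_. 0"] by (simp add: act_zero)
  ultimately show ?thesis by eventually_elim simp
qed

lemma sublinear_minus:
  assumes "sublinear q" "z \<in> carrier E"
  shows "AE \<omega> in M. 0 \<le> q z \<omega> + q (\<ominus>\<^bsub>E\<^esub> z) \<omega>"
proof -
  have "AE \<omega> in M. q \<zero>\<^bsub>E\<^esub> \<omega> \<le> q z \<omega> + q (\<ominus>\<^bsub>E\<^esub> z) \<omega>"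
    using sublinear_add[OF assms, of "\<ominus>\<^bsub>E\<^esub> z"] assms(2) by (simp add: r_neg)
  with sublinear_zero[OF assms(1)] show ?thesis by eventually_elim simp
qed

lemma act_minus:
  assumes "a \<in> borel_measurable M" "z \<in> carrier E"
  shows "act (\<lambda>\<omega>. - a \<omega>) z = \<ominus>\<^bsub>E\<^esub> act a z" "act a (\<ominus>\<^bsub>E\<^esub> z) = \<ominus>\<^bsub>E\<^esub> act a z"
proof -
  show "act (\<lambda>\<omega>. - a \<omega>) z = \<ominus>\<^bsub>E\<^esub> act a z"
    using act_times[of "\<lambda>_. -1" a z] assms by (simp add: act_minus_one act_closed)
  moreover have "act (\<lambda>\<omega>. - a \<omega>) z = act a (\<ominus>\<^bsub>E\<^esub> z)"
    using act_times[of a "\<lambda>_. -1" z] assms by (simp add: act_minus_one)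
  ultimately show "act a (\<ominus>\<^bsub>E\<^esub> z) = \<ominus>\<^bsub>E\<^esub> act a z" by simp
qed

text \<open>A nonnegative scalar \<open>a\<close> is invertible only where it is positive. There
  \<open>b\<close> is its inverse, and \<open>b * a\<close> is the indicator \<open>i\<close>, so
  \<open>b\<close> applied to \<open>act a z\<close> recovers the part \<open>act i z\<close>; the
  remaining part \<open>act j z\<close> contributes nothing at such points. Where \<open>a\<close>
  vanishes, the values at \<open>act a z\<close> and at its negative are both at most 0 with sum at
  least 0.\<close>

lemma sublinear_act:
  assumes q: "sublinear q" and a: "a \<in> borel_measurable M" "\<And>\<omega>. 0 \<le> a \<omega>" and z: "z \<in> carrier E"
  shows "AE \<omega> in M. q (act a z) \<omega> = a \<omega> * q z \<omega>"
proof -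
  define i j :: "'w \<Rightarrow> real" where "i \<omega> = (if 0 < a \<omega> then 1 else 0)" and "j \<omega> = (if 0 < a \<omega> then 0 else 1)" for \<omega>
  define b where "b \<omega> = (if 0 < a \<omega> then 1 / a \<omega> else 0)" for \<omega>
  have [measurable]: "a \<in> borel_measurable M" by fact
  have m [measurable]: "i \<in> borel_measurable M" "j \<in> borel_measurable M" "b \<in> borel_measurable M"
    unfolding i_def j_def b_def by measurable
  have [simp]: "0 \<le> i \<omega>" "0 \<le> j \<omega>" "0 \<le> b \<omega>" for \<omega>
    using a(2)[of \<omega>] by (auto simp: i_def j_def b_def)
  note cl = act_closed[OF a(1) z] act_closed[OF m(1) z] act_closed[OF m(2) z]
  have "i = (\<lambda>\<omega>. b \<omega> * a \<omega>)" by (auto simp: i_def b_def fun_eq_iff)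
  then have "act i z = act b (act a z)" using act_times[OF m(3) a(1) z] by simp
  then have 1: "AE \<omega> in M. q (act i z) \<omega> \<le> b \<omega> * q (act a z) \<omega>"
    using sublinear_act_le[OF q cl(1) m(3)] by simp
  have "(\<lambda>\<omega>. i \<omega> + j \<omega>) = (\<lambda>_. 1)" by (auto simp: i_def j_def fun_eq_iff)
  then have "act i z \<oplus>\<^bsub>E\<^esub> act j z = z" using act_plus[OF m(1,2) z] z by (simp add: act_one)
  then have 2: "AE \<omega> in M. q z \<omega> \<le> q (act i z) \<omega> + q (act j z) \<omega>"
    using sublinear_add[OF q cl(2,3)] by simp
  have 3: "AE \<omega> in M. q (act j z) \<omega> \<le> j \<omega> * q z \<omega>"
    using sublinear_act_le[OF q z m(2)] by simp
  have 4: "AE \<omega> in M. 0 \<le> q (act a z) \<omega> + q (\<ominus>\<^bsub>E\<^esub> act a z) \<omega>"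
    by (rule sublinear_minus[OF q cl(1)])
  have 5: "AE \<omega> in M. q (\<ominus>\<^bsub>E\<^esub> act a z) \<omega> \<le> a \<omega> * q (\<ominus>\<^bsub>E\<^esub> z) \<omega>"
    using sublinear_act_le[OF q _ a, of "\<ominus>\<^bsub>E\<^esub> z"] z by (simp add: act_minus a)
  have 6: "AE \<omega> in M. q (act a z) \<omega> \<le> a \<omega> * q z \<omega>"
    by (rule sublinear_act_le[OF q z a])
  from 1 2 3 4 5 6 show ?thesis
  proof eventually_elim
    case (elim \<omega>)
    show ?case
    proof (cases "0 < a \<omega>")
      case True
      then have "q z \<omega> \<le> q (act a z) \<omega> / a \<omega>"
        using elim(1-3) by (simp add: b_def j_def)
      then show ?thesis using elim(6) True by (simp add: field_simps)
    next
      case False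
      then have "a \<omega> = 0" using a(2)[of \<omega>] by simp
      then show ?thesis using elim(4-6) by simp
    qed
  qed
qed

text \<open>Sublinearity of an infimum needs only that sums and nonnegative multiples of competitors
  can be improved by competitors at the corresponding point. This common core serves the infimum
  over translates by a convex set and the infimum of a chain.\<close>

lemma sublinear_essential_infimum:
  fixes G :: "'e \<Rightarrow> ('w \<Rightarrow> real) set"
  assumes G: "\<And>z. z \<in> carrier E \<Longrightarrow> G z \<noteq> {}" "\<And>z. z \<in> carrier E \<Longrightarrow> G z \<subseteq> borel_measurable M"
    and l: "\<And>z g. z \<in> carrier E \<Longrightarrow> g \<in> G z \<Longrightarrow> AE \<omega> in M. l z \<omega> \<le> g \<omega>"
    and add: "\<And>z w g h. z \<in> carrier E \<Longrightarrow> w \<in> carrier E \<Longrightarrow> g \<in> G z \<Longrightarrow> h \<in> G w \<Longrightarrow>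
      \<exists>k\<in>G (z \<oplus>\<^bsub>E\<^esub> w). AE \<omega> in M. k \<omega> \<le> g \<omega> + h \<omega>"
    and scale: "\<And>a z g. a \<in> borel_measurable M \<Longrightarrow> (\<And>\<omega>. 0 \<le> a \<omega>) \<Longrightarrow> z \<in> carrier E \<Longrightarrow> g \<in> G z \<Longrightarrow>
      \<exists>k\<in>G (act a z). AE \<omega> in M. k \<omega> \<le> a \<omega> * g \<omega>"
  shows "\<exists>q. sublinear q \<and> (\<forall>z\<in>carrier E. \<forall>g\<in>G z. AE \<omega> in M. q z \<omega> \<le> g \<omega>)"
proof -
  define P where "P z h \<longleftrightarrow> h \<in> borel_measurable M \<and> (\<forall>g\<in>G z. AE \<omega> in M. h \<omega> \<le> g \<omega>) \<and>
      (\<forall>k. (\<forall>g\<in>G z. AE \<omega> in M. k \<omega> \<le> g \<omega>) \<longrightarrow> (AE \<omega> in M. k \<omega> \<le> h \<omega>))" for z h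
  have "\<exists>h. P z h" if z: "z \<in> carrier E" for z
    unfolding P_def by (rule essential_infimum_real[OF G[OF z]]) (rule l[OF z])
  then have "\<forall>z\<in>carrier E. \<exists>h. P z h" by blast
  from bchoice[OF this] obtain q where "\<forall>z\<in>carrier E. P z (q z)" by blast
  then have q: "\<And>z. z \<in> carrier E \<Longrightarrow> q z \<in> borel_measurable M"
    "\<And>z g. z \<in> carrier E \<Longrightarrow> g \<in> G z \<Longrightarrow> AE \<omega> in M. q z \<omega> \<le> g \<omega>"
    "\<And>z k. z \<in> carrier E \<Longrightarrow> \<forall>g\<in>G z. AE \<omega> in M. k \<omega> \<le> g \<omega> \<Longrightarrow> AE \<omega> in M. k \<omega> \<le> q z \<omega>"
    unfolding P_def by blast+
  have q_add: "AE \<omega> in M. q (z \<oplus>\<^bsub>E\<^esub> w) \<omega> \<le> q z \<omega> + q w \<omega>"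
    if z: "z \<in> carrier E" and w: "w \<in> carrier E" for z w
  proof -
    \<comment> \<open>Essential infima are compared one variable at a time: with \<open>g\<close>
      fixed the infimum over \<open>h\<close> is taken first, then the one over \<open>g\<close>. A
      simultaneous comparison would involve uncountably many null sets.\<close>
    have "AE \<omega> in M. q (z \<oplus>\<^bsub>E\<^esub> w) \<omega> - q w \<omega> \<le> g \<omega>" if g: "g \<in> G z" for g
    proof -
      have "AE \<omega> in M. q (z \<oplus>\<^bsub>E\<^esub> w) \<omega> - g \<omega> \<le> h \<omega>" if h: "h \<in> G w" for h
      proof -
        obtain k where k: "k \<in> G (z \<oplus>\<^bsub>E\<^esub> w)" "AE \<omega> in M. k \<omega> \<le> g \<omega> + h \<omega>"
          using add[OF z w g h] by blast
        from q(2)[OF _ k(1)] z w have "AE \<omega> in M. q (z \<oplus>\<^bsub>E\<^esub> w) \<omega> \<le> k \<omega>" by simp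
        with k(2) show ?thesis by eventually_elim simp
      qed
      then have "AE \<omega> in M. q (z \<oplus>\<^bsub>E\<^esub> w) \<omega> - g \<omega> \<le> q w \<omega>"
        by (intro q(3)[OF w]) blast
      then show ?thesis by eventually_elim simp
    qed
    then have "AE \<omega> in M. q (z \<oplus>\<^bsub>E\<^esub> w) \<omega> - q w \<omega> \<le> q z \<omega>"
      by (intro q(3)[OF z]) blast
    then show ?thesis by eventually_elim simp
  qed
  have q_act: "AE \<omega> in M. q (act a z) \<omega> \<le> a \<omega> * q z \<omega>"
    if a: "a \<in> borel_measurable M" "\<And>\<omega>. 0 \<le> a \<omega>" and z: "z \<in> carrier E" for a z
  proof -
    have le: "AE \<omega> in M. q (act a z) \<omega> \<le> a \<omega> * g \<omega>" if g: "g \<in> G z" for g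
    proof -
      obtain k where k: "k \<in> G (act a z)" "AE \<omega> in M. k \<omega> \<le> a \<omega> * g \<omega>"
        using scale[OF a z g] by blast
      have "AE \<omega> in M. q (act a z) \<omega> \<le> k \<omega>"
        by (rule q(2)[OF act_closed[OF a(1) z] k(1)])
      with k(2) show ?thesis by eventually_elim simp
    qed
    \<comment> \<open>The test function divides by \<open>a\<close> where this is possible and is
      \<open>q z\<close> elsewhere, so it is a lower bound of \<open>G z\<close> everywhere. Where
      \<open>a\<close> is 0, the inequality \<open>le\<close> for any single member already reads
      \<open>q (act a z) \<le> 0\<close>.\<close>
    have "AE \<omega> in M. (if 0 < a \<omega> then q (act a z) \<omega> / a \<omega> else q z \<omega>) \<le> g \<omega>" if g: "g \<in> G z" for g
      using le[OF g] q(2)[OF z g] by eventually_elim (auto simp: field_simps)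
    then have 1: "AE \<omega> in M. (if 0 < a \<omega> then q (act a z) \<omega> / a \<omega> else q z \<omega>) \<le> q z \<omega>"
      by (intro q(3)[OF z]) blast
    obtain g where "g \<in> G z" using G(1)[OF z] by blast
    from 1 le[OF this] show ?thesis
    proof eventually_elim
      case (elim \<omega>)
      show ?case
        using elim a(2)[of \<omega>] by (cases "0 < a \<omega>") (auto simp: field_simps order.order_iff_strict)
    qed
  qed
  show ?thesis
    using q(1,2) q_add q_act by (intro exI[of _ q]) (auto simp: sublinear_def)
qed

text \<open>
  The infimum \<open>q' z = inf {q (z + t c) - t d : t \<ge> 0, c \<in> D}\<close> is sublinear because \<open>D\<close> is convex:
  \<open>t c + s c'\<close> is \<open>t + s\<close> times an element of \<open>D\<close>. It is finite because \<open>d \<le> q\<close> on \<open>D\<close>.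
\<close>
lemma sublinear_below_on_convex:
  assumes q: "sublinear q" and D: "D \<noteq> {}" "D \<subseteq> carrier E" and d: "d \<in> borel_measurable M"
    and le: "\<And>c. c \<in> D \<Longrightarrow> AE \<omega> in M. d \<omega> \<le> q c \<omega>"
    and convex: "\<And>c c' \<xi>. c \<in> D \<Longrightarrow> c' \<in> D \<Longrightarrow> \<xi> \<in> borel_measurable M \<Longrightarrow>
      (\<And>\<omega>. 0 \<le> \<xi> \<omega> \<and> \<xi> \<omega> \<le> 1) \<Longrightarrow> act \<xi> c \<oplus>\<^bsub>E\<^esub> act (\<lambda>\<omega>. 1 - \<xi> \<omega>) c' \<in> D"
  shows "\<exists>q'. sublinear q' \<and> dominated q' q \<and> (\<forall>c\<in>D. AE \<omega> in M. q' (\<ominus>\<^bsub>E\<^esub> c) \<omega> \<le> - d \<omega>)"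
proof -
  define T where "T = {t :: 'w \<Rightarrow> real. t \<in> borel_measurable M \<and> (\<forall>\<omega>. 0 \<le> t \<omega>)}"
  define g where "g z t c = (\<lambda>\<omega>. q (z \<oplus>\<^bsub>E\<^esub> act t c) \<omega> - t \<omega> * d \<omega>)" for z t c
  define G where "G z = {g z t c | t c. t \<in> T \<and> c \<in> D}" for z
  have T [measurable_dest]: "t \<in> borel_measurable M" if "t \<in> T" for t using that by (simp add: T_def)
  have T0: "0 \<le> t \<omega>" if "t \<in> T" for t \<omega> using that by (simp add: T_def)
  have zT: "(\<lambda>_. 0) \<in> T" "(\<lambda>_. 1) \<in> T" by (auto simp: T_def)
  have ac: "act t c \<in> carrier E" if "t \<in> T" "c \<in> D" for t c
    using that D(2) by (intro act_closed T) auto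
  have 1: "G z \<noteq> {}" if "z \<in> carrier E" for z
    using zT D(1) by (auto simp: G_def)
  have 2: "G z \<subseteq> borel_measurable M" if z: "z \<in> carrier E" for z
  proof
    fix h assume "h \<in> G z"
    then obtain t c where h: "h = g z t c" and t: "t \<in> T" and c: "c \<in> D" by (auto simp: G_def)
    have "q (z \<oplus>\<^bsub>E\<^esub> act t c) \<in> borel_measurable M"
      by (rule sublinear_measurable[OF q]) (use z ac[OF t c] in simp)
    with d T[OF t] show "h \<in> borel_measurable M" unfolding h g_def by measurable
  qed
  \<comment> \<open>Writing \<open>t c\<close> as \<open>(z + t c) - z\<close> gives the bound. The
    exact homogeneity of \<open>sublinear_act\<close> is essential:
    \<open>q (t c) \<ge> t q c\<close> is the direction that the sublinear inequality does not
    provide.\<close>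
  have 3: "AE \<omega> in M. - q (\<ominus>\<^bsub>E\<^esub> z) \<omega> \<le> h \<omega>" if z: "z \<in> carrier E" and h: "h \<in> G z" for z h
  proof -
    obtain t c where h: "h = g z t c" and t: "t \<in> T" and c: "c \<in> D" using h by (auto simp: G_def)
    note a = ac[OF t c]
    have "z \<oplus>\<^bsub>E\<^esub> act t c \<oplus>\<^bsub>E\<^esub> \<ominus>\<^bsub>E\<^esub> z = act t c"
      using z a by (metis a_comm add.inv_closed add.inv_solve_right' a_closed)
    then have "AE \<omega> in M. q (act t c) \<omega> \<le> q (z \<oplus>\<^bsub>E\<^esub> act t c) \<omega> + q (\<ominus>\<^bsub>E\<^esub> z) \<omega>"
      using sublinear_add[OF q, of "z \<oplus>\<^bsub>E\<^esub> act t c" "\<ominus>\<^bsub>E\<^esub> z"] z a by simp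
    moreover have "AE \<omega> in M. q (act t c) \<omega> = t \<omega> * q c \<omega>"
      by (rule sublinear_act[OF q T[OF t] T0[OF t]]) (use c D(2) in auto)
    ultimately show ?thesis using le[OF c]
    proof eventually_elim
      case (elim \<omega>)
      have "t \<omega> * d \<omega> \<le> t \<omega> * q c \<omega>" by (rule mult_left_mono[OF elim(3) T0[OF t]])
      with elim show ?case unfolding h g_def by linarith
    qed
  qed
  have 4: "\<exists>k\<in>G (z \<oplus>\<^bsub>E\<^esub> w). AE \<omega> in M. k \<omega> \<le> h \<omega> + h' \<omega>"
    if z: "z \<in> carrier E" and w: "w \<in> carrier E" and h: "h \<in> G z" and h': "h' \<in> G w" for z w h h'
  proof -
    obtain t c where h: "h = g z t c" and t: "t \<in> T" and c: "c \<in> D" using h by (auto simp: G_def)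
    obtain s c' where h': "h' = g w s c'" and s: "s \<in> T" and c': "c' \<in> D" using h' by (auto simp: G_def)
    define u where "u = (\<lambda>\<omega>. t \<omega> + s \<omega>)"
    \<comment> \<open>Where \<open>u\<close> is 0, division by zero gives \<open>\<xi> = 0\<close>;
      as \<open>t\<close> and \<open>s\<close> vanish there too, the products
      \<open>u \<xi> = t\<close> and \<open>u (1 - \<xi>) = s\<close> still hold everywhere.\<close>
    define \<xi> where "\<xi> = (\<lambda>\<omega>. t \<omega> / u \<omega>)"
    define c'' where "c'' = act \<xi> c \<oplus>\<^bsub>E\<^esub> act (\<lambda>\<omega>. 1 - \<xi> \<omega>) c'"
    have u: "u \<in> T" using s t by (auto simp: T_def u_def)
    have um: "u \<in> borel_measurable M" by (rule T[OF u])
    have \<xi>m: "\<xi> \<in> borel_measurable M" unfolding \<xi>_def using T[OF t] um by measurable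
    have \<xi>m': "(\<lambda>\<omega>. 1 - \<xi> \<omega>) \<in> borel_measurable M" using \<xi>m by measurable
    have \<xi>01: "0 \<le> \<xi> \<omega> \<and> \<xi> \<omega> \<le> 1" for \<omega>
      using T0[OF t, of \<omega>] T0[OF s, of \<omega>] by (auto simp: \<xi>_def u_def divide_le_eq_1)
    have c'': "c'' \<in> D" unfolding c''_def by (rule convex[OF c c' \<xi>m \<xi>01])
    have cc: "c \<in> carrier E" "c' \<in> carrier E" using c c' D(2) by auto
    have ut: "(\<lambda>\<omega>. u \<omega> * \<xi> \<omega>) = t" "(\<lambda>\<omega>. u \<omega> * (1 - \<xi> \<omega>)) = s"
    proof -
      have "u \<omega> * \<xi> \<omega> = t \<omega>" for \<omega>
        using T0[OF t, of \<omega>] T0[OF s, of \<omega>] by (cases "u \<omega> = 0") (auto simp: \<xi>_def u_def)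
      then show "(\<lambda>\<omega>. u \<omega> * \<xi> \<omega>) = t" "(\<lambda>\<omega>. u \<omega> * (1 - \<xi> \<omega>)) = s"
        by (auto simp: fun_eq_iff right_diff_distrib u_def)
    qed
    have "act u c'' = act u (act \<xi> c) \<oplus>\<^bsub>E\<^esub> act u (act (\<lambda>\<omega>. 1 - \<xi> \<omega>) c')"
      unfolding c''_def by (rule act_add[OF um]) (intro act_closed \<xi>m \<xi>m' cc)+
    also have "\<dots> = act t c \<oplus>\<^bsub>E\<^esub> act s c'"
      using act_times[OF um \<xi>m cc(1)] act_times[OF um \<xi>m' cc(2)] by (simp add: ut)
    finally have uc: "act u c'' = act t c \<oplus>\<^bsub>E\<^esub> act s c'" .
    have "(z \<oplus>\<^bsub>E\<^esub> act t c) \<oplus>\<^bsub>E\<^esub> (w \<oplus>\<^bsub>E\<^esub> act s c') = (z \<oplus>\<^bsub>E\<^esub> w) \<oplus>\<^bsub>E\<^esub> act u c''"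
      unfolding uc using z w ac[OF t c] ac[OF s c'] by (simp add: a_ac)
    then have "AE \<omega> in M. q ((z \<oplus>\<^bsub>E\<^esub> w) \<oplus>\<^bsub>E\<^esub> act u c'') \<omega> \<le> q (z \<oplus>\<^bsub>E\<^esub> act t c) \<omega> + q (w \<oplus>\<^bsub>E\<^esub> act s c') \<omega>"
      using sublinear_add[OF q, of "z \<oplus>\<^bsub>E\<^esub> act t c" "w \<oplus>\<^bsub>E\<^esub> act s c'"] z w ac[OF t c] ac[OF s c'] by simp
    then have "AE \<omega> in M. g (z \<oplus>\<^bsub>E\<^esub> w) u c'' \<omega> \<le> h \<omega> + h' \<omega>"
      unfolding h h' g_def by eventually_elim (simp add: u_def algebra_simps)
    moreover have "g (z \<oplus>\<^bsub>E\<^esub> w) u c'' \<in> G (z \<oplus>\<^bsub>E\<^esub> w)" using u c'' by (auto simp: G_def)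
    ultimately show ?thesis by blast
  qed
  have 5: "\<exists>k\<in>G (act a z). AE \<omega> in M. k \<omega> \<le> a \<omega> * h \<omega>"
    if a: "a \<in> borel_measurable M" "\<And>\<omega>. 0 \<le> a \<omega>" and z: "z \<in> carrier E" and h: "h \<in> G z" for a z h
  proof -
    obtain t c where h: "h = g z t c" and t: "t \<in> T" and c: "c \<in> D" using h by (auto simp: G_def)
    have cc: "c \<in> carrier E" using c D(2) by auto
    have at: "(\<lambda>\<omega>. a \<omega> * t \<omega>) \<in> T" using a t by (auto simp: T_def)
    have "act a (z \<oplus>\<^bsub>E\<^esub> act t c) = act a z \<oplus>\<^bsub>E\<^esub> act (\<lambda>\<omega>. a \<omega> * t \<omega>) c"
      using act_add[OF a(1) z ac[OF t c]] act_times[OF a(1) T[OF t] cc] by simp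
    then have "AE \<omega> in M. q (act a z \<oplus>\<^bsub>E\<^esub> act (\<lambda>\<omega>. a \<omega> * t \<omega>) c) \<omega> \<le> a \<omega> * q (z \<oplus>\<^bsub>E\<^esub> act t c) \<omega>"
      using sublinear_act_le[OF q _ a, of "z \<oplus>\<^bsub>E\<^esub> act t c"] z ac[OF t c] by simp
    then have "AE \<omega> in M. g (act a z) (\<lambda>\<omega>. a \<omega> * t \<omega>) c \<omega> \<le> a \<omega> * h \<omega>"
      unfolding h g_def by eventually_elim (simp add: algebra_simps)
    moreover have "g (act a z) (\<lambda>\<omega>. a \<omega> * t \<omega>) c \<in> G (act a z)" using at c by (auto simp: G_def)
    ultimately show ?thesis by blast
  qed
  have "\<exists>q'. sublinear q' \<and> (\<forall>z\<in>carrier E. \<forall>h\<in>G z. AE \<omega> in M. q' z \<omega> \<le> h \<omega>)"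
    by (rule sublinear_essential_infimum) (assumption | rule 1 2 3 4 5)+
  then obtain q' where q': "sublinear q'"
    "\<And>z h. z \<in> carrier E \<Longrightarrow> h \<in> G z \<Longrightarrow> AE \<omega> in M. q' z \<omega> \<le> h \<omega>" by blast
  have gG: "g z t c \<in> G z" if "t \<in> T" "c \<in> D" for z t c using that by (auto simp: G_def)
  have "AE \<omega> in M. q' z \<omega> \<le> q z \<omega>" if z: "z \<in> carrier E" for z
  proof -
    obtain c where c: "c \<in> D" using D(1) by blast
    \<comment> \<open>The competitor with \<open>t = 0\<close> is \<open>q z\<close> itself.\<close>
    then have "g z (\<lambda>_. 0) c = q z" using z D(2) by (auto simp: g_def act_zero)
    with q'(2)[OF z gG[OF zT(1) c]] show ?thesis by simp
  qed
  moreover have "AE \<omega> in M. q' (\<ominus>\<^bsub>E\<^esub> c) \<omega> \<le> - d \<omega>" if c: "c \<in> D" for c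
  proof -
    have cc: "c \<in> carrier E" using c D(2) by auto
    \<comment> \<open>The competitor with \<open>t = 1\<close> cancels the point, leaving
      \<open>q\<close> at the null element minus \<open>d\<close>.\<close>
    have "g (\<ominus>\<^bsub>E\<^esub> c) (\<lambda>_. 1) c = (\<lambda>\<omega>. q \<zero>\<^bsub>E\<^esub> \<omega> - d \<omega>)"
      using cc by (simp add: g_def act_one l_neg)
    with q'(2)[OF _ gG[OF zT(2) c], of "\<ominus>\<^bsub>E\<^esub> c"] cc
    have "AE \<omega> in M. q' (\<ominus>\<^bsub>E\<^esub> c) \<omega> \<le> q \<zero>\<^bsub>E\<^esub> \<omega> - d \<omega>" by simp
    with sublinear_zero[OF q] show ?thesis by eventually_elim simp
  qed
  ultimately show ?thesis using q'(1) by (auto simp: dominated_def)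
qed

text \<open>Domination is only a preorder, since functionals that agree almost everywhere can be
  distinct; hence a maximal chain and its essential infimum instead of an order-theoretic minimum. A
  sublinear \<open>q\<close> below the infimum is comparable with the whole chain, so it belongs to
  the chain and lies above the infimum. The values \<open>- p (- z)\<close> bound the chain from
  below and keep the infimum finite.\<close>

lemma minimal_sublinear:
  assumes p: "sublinear p"
  shows "\<exists>m. sublinear m \<and> dominated m p \<and> (\<forall>q. sublinear q \<longrightarrow> dominated q m \<longrightarrow> dominated m q)"
proof -
  define A where "A = {q. sublinear q \<and> dominated q p}"
  have refl: "dominated q q" for q by (auto simp: dominated_def)
  obtain C where C: "pred_on.maxchain A dominated C"
    using pred_on.Hausdorff[of A dominated] by blast
  then have chain: "C \<subseteq> A" "\<And>q r. q \<in> C \<Longrightarrow> r \<in> C \<Longrightarrow> dominated q r \<or> dominated r q"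
    using refl by (auto simp: pred_on.maxchain_def pred_on.chain_def)
  have max: "q \<in> C" if "q \<in> A" "\<And>r. r \<in> C \<Longrightarrow> dominated q r \<or> dominated r q" for q
  proof (rule ccontr)
    assume "q \<notin> C"
    moreover have "pred_on.chain A dominated (insert q C)"
      using that chain refl by (auto simp: pred_on.chain_def)
    ultimately show False using C by (auto simp: pred_on.maxchain_def)
  qed
  have pC: "p \<in> C"
    by (rule max) (use p refl chain(1) in \<open>auto simp: A_def\<close>)
  have CA: "sublinear q" "dominated q p" if "q \<in> C" for q
    using that chain(1) by (auto simp: A_def)
  define G where "G z = {q z | q. q \<in> C}" for z
  have 1: "G z \<noteq> {}" for z using pC by (auto simp: G_def)
  have 2: "G z \<subseteq> borel_measurable M" if "z \<in> carrier E" for z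
    using sublinear_measurable[OF CA(1) that] by (auto simp: G_def)
  have 3: "AE \<omega> in M. - p (\<ominus>\<^bsub>E\<^esub> z) \<omega> \<le> g \<omega>" if z: "z \<in> carrier E" and g: "g \<in> G z" for z g
  proof -
    obtain q where g: "g = q z" and q: "q \<in> C" using g by (auto simp: G_def)
    have "AE \<omega> in M. q (\<ominus>\<^bsub>E\<^esub> z) \<omega> \<le> p (\<ominus>\<^bsub>E\<^esub> z) \<omega>"
      using CA(2)[OF q] z by (simp add: dominated_def)
    with sublinear_minus[OF CA(1)[OF q] z] show ?thesis unfolding g by eventually_elim simp
  qed
  have 4: "\<exists>k\<in>G (z \<oplus>\<^bsub>E\<^esub> w). AE \<omega> in M. k \<omega> \<le> g \<omega> + h \<omega>"
    if z: "z \<in> carrier E" and w: "w \<in> carrier E" and g: "g \<in> G z" and h: "h \<in> G w" for z w g h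
  proof -
    obtain q r where g: "g = q z" and q: "q \<in> C" and h: "h = r w" and r: "r \<in> C"
      using g h by (auto simp: G_def)
    \<comment> \<open>Two members of a chain are comparable, so the smaller one bounds both summands
      and its own subadditivity applies.\<close>
    obtain s where s: "s \<in> C" "dominated s q" "dominated s r"
      using chain(2)[OF q r] q r refl by blast
    have "AE \<omega> in M. s z \<omega> \<le> q z \<omega>" "AE \<omega> in M. s w \<omega> \<le> r w \<omega>"
      using s z w by (auto simp: dominated_def)
    with sublinear_add[OF CA(1)[OF s(1)] z w]
    have "AE \<omega> in M. s (z \<oplus>\<^bsub>E\<^esub> w) \<omega> \<le> g \<omega> + h \<omega>"
      unfolding g h by eventually_elim simp
    then show ?thesis using s(1) by (auto simp: G_def)
  qed
  have 5: "\<exists>k\<in>G (act a z). AE \<omega> in M. k \<omega> \<le> a \<omega> * g \<omega>"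
    if a: "a \<in> borel_measurable M" "\<And>\<omega>. 0 \<le> a \<omega>" and z: "z \<in> carrier E" and g: "g \<in> G z" for a z g
  proof -
    obtain q where g: "g = q z" and q: "q \<in> C" using g by (auto simp: G_def)
    show ?thesis using sublinear_act_le[OF CA(1)[OF q] z a] q unfolding g by (auto simp: G_def)
  qed
  have "\<exists>m. sublinear m \<and> (\<forall>z\<in>carrier E. \<forall>g\<in>G z. AE \<omega> in M. m z \<omega> \<le> g \<omega>)"
    by (rule sublinear_essential_infimum) (assumption | rule 1 2 3 4 5)+
  then obtain m where m: "sublinear m"
    "\<And>z g. z \<in> carrier E \<Longrightarrow> g \<in> G z \<Longrightarrow> AE \<omega> in M. m z \<omega> \<le> g \<omega>" by blast
  have mC: "dominated m q" if "q \<in> C" for q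
    using m(2) that by (auto simp: dominated_def G_def)
  have "dominated m q" if q: "sublinear q" "dominated q m" for q
  proof -
    have qC: "dominated q r" if "r \<in> C" for r
      by (rule dominated_trans[OF q(2) mC[OF that]])
    have "q \<in> C"
      by (rule max) (use q(1) qC pC in \<open>auto simp: A_def\<close>)
    then show ?thesis by (rule mC)
  qed
  with m(1) mC[OF pC] show ?thesis by blast
qed

text \<open>For the singleton \<open>{z}\<close> and \<open>d = m z\<close>,
  \<open>sublinear_below_on_convex\<close> yields a functional below \<open>m\<close> whose value at
  \<open>- z\<close> is at most \<open>- m z\<close>. Minimality transfers this to \<open>m\<close>,
  so \<open>m\<close> is odd. Oddness turns subadditivity into additivity, and splitting a scalar
  into positive and negative parts extends homogeneity to all signs.\<close>

lemma minimal_sublinear_linear: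
  assumes m: "sublinear m" and min: "\<And>q. sublinear q \<Longrightarrow> dominated q m \<Longrightarrow> dominated m q"
  shows "linear m"
proof -
  have neg: "AE \<omega> in M. m (\<ominus>\<^bsub>E\<^esub> z) \<omega> = - m z \<omega>" if z: "z \<in> carrier E" for z
  proof -
    have "act \<xi> z \<oplus>\<^bsub>E\<^esub> act (\<lambda>\<omega>. 1 - \<xi> \<omega>) z = z" if "\<xi> \<in> borel_measurable M" for \<xi>
      using act_plus[of \<xi> "\<lambda>\<omega>. 1 - \<xi> \<omega>" z] z that by (simp add: act_one)
    then have "\<exists>q'. sublinear q' \<and> dominated q' m \<and> (\<forall>c\<in>{z}. AE \<omega> in M. q' (\<ominus>\<^bsub>E\<^esub> c) \<omega> \<le> - m z \<omega>)"
      using z by (intro sublinear_below_on_convex[OF m]) (auto intro: sublinear_measurable[OF m])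
    then obtain q' where q': "sublinear q'" "dominated q' m" "AE \<omega> in M. q' (\<ominus>\<^bsub>E\<^esub> z) \<omega> \<le> - m z \<omega>"
      by auto
    have "AE \<omega> in M. m (\<ominus>\<^bsub>E\<^esub> z) \<omega> \<le> q' (\<ominus>\<^bsub>E\<^esub> z) \<omega>"
      using min[OF q'(1,2)] z by (simp add: dominated_def)
    with q'(3) sublinear_minus[OF m z] show ?thesis by eventually_elim simp
  qed
  have add: "AE \<omega> in M. m (z \<oplus>\<^bsub>E\<^esub> w) \<omega> = m z \<omega> + m w \<omega>"
    if z: "z \<in> carrier E" and w: "w \<in> carrier E" for z w
  proof -
    have "AE \<omega> in M. m (\<ominus>\<^bsub>E\<^esub> (z \<oplus>\<^bsub>E\<^esub> w)) \<omega> \<le> m (\<ominus>\<^bsub>E\<^esub> z) \<omega> + m (\<ominus>\<^bsub>E\<^esub> w) \<omega>"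
      using sublinear_add[OF m, of "\<ominus>\<^bsub>E\<^esub> z" "\<ominus>\<^bsub>E\<^esub> w"] z w by (simp add: minus_add)
    moreover have "AE \<omega> in M. m (\<ominus>\<^bsub>E\<^esub> (z \<oplus>\<^bsub>E\<^esub> w)) \<omega> = - m (z \<oplus>\<^bsub>E\<^esub> w) \<omega>"
      using neg[of "z \<oplus>\<^bsub>E\<^esub> w"] z w by simp
    ultimately show ?thesis using neg[OF z] neg[OF w] sublinear_add[OF m z w]
      by eventually_elim simp
  qed
  have "AE \<omega> in M. m (act a z) \<omega> = a \<omega> * m z \<omega>" if a: "a \<in> borel_measurable M" and z: "z \<in> carrier E" for a z
  proof -
    define u v where "u = (\<lambda>\<omega>. max (a \<omega>) 0)" and "v = (\<lambda>\<omega>. max (- a \<omega>) 0)"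
    have uv: "u \<in> borel_measurable M" "v \<in> borel_measurable M"
      using a by (simp_all add: u_def v_def)
    have a_eq: "a = (\<lambda>\<omega>. u \<omega> + - v \<omega>)" by (auto simp: u_def v_def fun_eq_iff)
    have "act a z = act u z \<oplus>\<^bsub>E\<^esub> act (\<lambda>\<omega>. - v \<omega>) z"
      unfolding a_eq by (rule act_plus) (use uv z in auto)
    then have az: "act a z = act u z \<oplus>\<^bsub>E\<^esub> \<ominus>\<^bsub>E\<^esub> act v z"
      using act_minus(1)[OF uv(2) z] by simp
    note cl = act_closed[OF uv(1) z] act_closed[OF uv(2) z]
    have "AE \<omega> in M. m (act a z) \<omega> = m (act u z) \<omega> + m (\<ominus>\<^bsub>E\<^esub> act v z) \<omega>"
      unfolding az using cl by (intro add) auto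
    moreover have "AE \<omega> in M. m (act u z) \<omega> = u \<omega> * m z \<omega>" "AE \<omega> in M. m (act v z) \<omega> = v \<omega> * m z \<omega>"
      by (intro sublinear_act[OF m _ _ z] uv; simp add: u_def v_def)+
    ultimately show ?thesis using neg[OF cl(2)]
      by eventually_elim (simp add: a_eq algebra_simps)
  qed
  with add sublinear_measurable[OF m] show ?thesis by (auto simp: linear_def)
qed

text \<open>A lower bound on \<open>D\<close> does not pass to smaller functionals, but the upper
  bound \<open>q (- c) \<le> - d\<close> at the negatives does. It survives down to the minimal
  \<open>m\<close>, where linearity, or already \<open>sublinear_minus\<close>, turns it back into
  \<open>d \<le> m c\<close>.\<close>

lemma linear_between:
  assumes "sublinear p" and "D \<noteq> {}" "D \<subseteq> carrier E" and "d \<in> borel_measurable M"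
    and "\<And>c. c \<in> D \<Longrightarrow> AE \<omega> in M. d \<omega> \<le> p c \<omega>"
    and "\<And>c c' \<xi>. c \<in> D \<Longrightarrow> c' \<in> D \<Longrightarrow> \<xi> \<in> borel_measurable M \<Longrightarrow>
      (\<And>\<omega>. 0 \<le> \<xi> \<omega> \<and> \<xi> \<omega> \<le> 1) \<Longrightarrow> act \<xi> c \<oplus>\<^bsub>E\<^esub> act (\<lambda>\<omega>. 1 - \<xi> \<omega>) c' \<in> D"
  shows "\<exists>f. linear f \<and> dominated f p \<and> (\<forall>c\<in>D. AE \<omega> in M. d \<omega> \<le> f c \<omega>)"
proof -
  obtain q where q: "sublinear q" "dominated q p" "\<And>c. c \<in> D \<Longrightarrow> AE \<omega> in M. q (\<ominus>\<^bsub>E\<^esub> c) \<omega> \<le> - d \<omega>"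
    using sublinear_below_on_convex[OF assms] by blast
  obtain m where m: "sublinear m" "dominated m q"
    "\<And>r. sublinear r \<Longrightarrow> dominated r m \<Longrightarrow> dominated m r"
    using minimal_sublinear[OF q(1)] by blast
  have lin: "linear m" by (rule minimal_sublinear_linear[OF m(1,3)])
  have "AE \<omega> in M. d \<omega> \<le> m c \<omega>" if c: "c \<in> D" for c
  proof -
    have cc: "c \<in> carrier E" using c assms(3) by blast
    then have "AE \<omega> in M. m (\<ominus>\<^bsub>E\<^esub> c) \<omega> \<le> q (\<ominus>\<^bsub>E\<^esub> c) \<omega>"
      using m(2) by (simp add: dominated_def)
    with sublinear_minus[OF m(1) cc] q(3)[OF c] show ?thesis by eventually_elim simp
  qed
  with lin dominated_trans[OF m(2) q(2)] show ?thesis by blast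
qed

lemma linearD:
  assumes "linear f" "z \<in> carrier E"
  shows linear_measurable: "f z \<in> borel_measurable M"
    and linear_add: "w \<in> carrier E \<Longrightarrow> AE \<omega> in M. f (z \<oplus>\<^bsub>E\<^esub> w) \<omega> = f z \<omega> + f w \<omega>"
    and linear_act: "a \<in> borel_measurable M \<Longrightarrow> AE \<omega> in M. f (act a z) \<omega> = a \<omega> * f z \<omega>"
  using assms by (auto simp: linear_def)

lemma linear_minus:
  assumes "linear f" "z \<in> carrier E"
  shows "AE \<omega> in M. f (\<ominus>\<^bsub>E\<^esub> z) \<omega> = - f z \<omega>"
  using linear_act[OF assms, of "\<lambda>_. -1"] assms(2) by (simp add: act_minus_one)

lemma linear_indicator_mult:
  assumes f: "linear f" and B: "B \<in> sets M"
  shows "linear (\<lambda>z \<omega>. indicator B \<omega> * f z \<omega>)"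
  unfolding linear_def
proof (intro conjI ballI)
  show "(\<lambda>\<omega>. indicator B \<omega> * f z \<omega>) \<in> borel_measurable M" if "z \<in> carrier E" for z
    using linear_measurable[OF f that] B by simp
  show "AE \<omega> in M. indicator B \<omega> * f (z \<oplus>\<^bsub>E\<^esub> w) \<omega> = indicator B \<omega> * f z \<omega> + indicator B \<omega> * f w \<omega>"
    if "z \<in> carrier E" "w \<in> carrier E" for z w
    using linear_add[OF f that] by eventually_elim (simp add: algebra_simps)
  show "AE \<omega> in M. indicator B \<omega> * f (act a z) \<omega> = a \<omega> * (indicator B \<omega> * f z \<omega>)"
    if "a \<in> borel_measurable M" "z \<in> carrier E" for a z
    using linear_act[OF f that(2,1)] by eventually_elim simp
qed

end

section \<open>Calculus of classes\<close>

lemma equiv_ae_rel: "equiv (measurable M N) (ae_rel M N)"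
proof (rule equivI)
  show "ae_rel M N \<subseteq> measurable M N \<times> measurable M N" "refl_on (measurable M N) (ae_rel M N)"
    by (auto simp: refl_on_def ae_rel_def)
  show "sym (ae_rel M N)"
    by (rule symI) (simp add: ae_rel_def eq_commute)
  show "trans (ae_rel M N)"
  proof (rule transI)
    fix f g h assume *: "(f, g) \<in> ae_rel M N" "(g, h) \<in> ae_rel M N"
    then have "AE \<omega> in M. f \<omega> = g \<omega>" "AE \<omega> in M. g \<omega> = h \<omega>" by (auto simp: ae_rel_def)
    then have "AE \<omega> in M. f \<omega> = h \<omega>" by eventually_elim simp
    with * show "(f, h) \<in> ae_rel M N" by (auto simp: ae_rel_def)
  qed
qed

lemma L0_class_in_L0: "f \<in> measurable M N \<Longrightarrow> L0_class M N f \<in> L0 M N"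
  by (simp add: L0_def L0_class_def quotientI)

lemma L0_class_eq_iff:
  assumes "f \<in> measurable M N" "g \<in> measurable M N"
  shows "L0_class M N f = L0_class M N g \<longleftrightarrow> (AE \<omega> in M. f \<omega> = g \<omega>)"
  using eq_equiv_class_iff[OF equiv_ae_rel assms] assms by (simp add: L0_class_def ae_rel_def)

lemma L0_class_exhaust:
  assumes "X \<in> L0 M N"
  shows "\<exists>f. f \<in> measurable M N \<and> X = L0_class M N f"
  using assms unfolding L0_def L0_class_def quotient_def by blast

lemma rep_in:
  assumes "X \<in> L0 M N"
  shows "rep X \<in> X"
proof -
  obtain f where "f \<in> measurable M N" "X = L0_class M N f"
    using L0_class_exhaust[OF assms] by blast
  then have "f \<in> X"
    by (simp add: L0_class_def ae_rel_def)
  then show ?thesis unfolding rep_def by (rule someI[of "\<lambda>f. f \<in> X"])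
qed

lemma rep_measurable:
  assumes "X \<in> L0 M N"
  shows "rep X \<in> measurable M N"
  using in_quotient_imp_subset[OF equiv_ae_rel, of X M N] rep_in[OF assms] assms
  unfolding L0_def by blast

lemma rep_L0_class:
  assumes "f \<in> measurable M N"
  shows "AE \<omega> in M. rep (L0_class M N f) \<omega> = f \<omega>"
proof -
  have "(f, rep (L0_class M N f)) \<in> ae_rel M N"
    using rep_in[OF L0_class_in_L0[OF assms]] unfolding L0_class_def by simp
  then have "AE \<omega> in M. f \<omega> = rep (L0_class M N f) \<omega>" by (simp add: ae_rel_def)
  then show ?thesis by eventually_elim simp
qed

lemma L0_class_rep:
  assumes "X \<in> L0 M N"
  shows "L0_class M N (rep X) = X"
proof -
  obtain f where f: "f \<in> measurable M N" "X = L0_class M N f"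
    using L0_class_exhaust[OF assms] by blast
  show ?thesis
    unfolding f(2) by (subst L0_class_eq_iff) (use f rep_measurable[OF assms] rep_L0_class[OF f(1)] in auto)
qed

text \<open>Measurability is asked of the two composites and not of \<open>h\<close>: for
  \<open>scalars K\<close>, sums and products take values in \<open>K\<close> only because their
  arguments do.\<close>

lemma L0_map2_class:
  assumes "f \<in> measurable M L" "g \<in> measurable M L" "(\<lambda>\<omega>. h (f \<omega>) (g \<omega>)) \<in> measurable M N"
    and "(\<lambda>\<omega>. h (rep (L0_class M L f) \<omega>) (rep (L0_class M L g) \<omega>)) \<in> measurable M N"
  shows "L0_map2 M N h (L0_class M L f) (L0_class M L g) = L0_class M N (\<lambda>\<omega>. h (f \<omega>) (g \<omega>))"
proof -
  have "AE \<omega> in M. h (rep (L0_class M L f) \<omega>) (rep (L0_class M L g) \<omega>) = h (f \<omega>) (g \<omega>)"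
    using rep_L0_class[OF assms(1)] rep_L0_class[OF assms(2)] by eventually_elim simp
  then show ?thesis unfolding L0_map2_def by (subst L0_class_eq_iff) (use assms in auto)
qed

lemma L0_map_class:
  assumes "f \<in> measurable M L" "(\<lambda>\<omega>. h (f \<omega>)) \<in> measurable M N"
    and "(\<lambda>\<omega>. h (rep (L0_class M L f) \<omega>)) \<in> measurable M N"
  shows "L0_map M N h (L0_class M L f) = L0_class M N (\<lambda>\<omega>. h (f \<omega>))"
proof -
  have "AE \<omega> in M. h (rep (L0_class M L f) \<omega>) = h (f \<omega>)"
    using rep_L0_class[OF assms(1)] by eventually_elim simp
  then show ?thesis unfolding L0_map_def by (subst L0_class_eq_iff) (use assms in auto)
qed

lemma to_bar_in_L0: "X \<in> L0 M borel \<Longrightarrow> to_bar M X \<in> L0 M borel"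
  unfolding to_bar_def L0_map_def by (intro L0_class_in_L0 borel_measurable_ereal rep_measurable)

lemma rep_to_bar: "X \<in> L0 M borel \<Longrightarrow> AE \<omega> in M. rep (to_bar M X) \<omega> = ereal (rep X \<omega>)"
  unfolding to_bar_def L0_map_def by (intro rep_L0_class borel_measurable_ereal rep_measurable)

subsection \<open>Suprema of extended real classes\<close>

text \<open>The lattice supremum is chosen by description, so a least upper bound has to be
  exhibited. Negation turns \<open>countable_essential_INF\<close> into a statement on suprema, and
  the pointwise supremum over a countable subfamily is measurable.\<close>

lemma (in finite_measure) least_Upper_L0_bar:
  assumes A: "A \<subseteq> L0 M borel"
  shows "least (L0_bar M) (\<Squnion>\<^bsub>L0_bar M\<^esub> A) (Upper (L0_bar M) A)"
proof -
  have "(\<lambda>X \<omega>. - rep X \<omega>) ` A \<subseteq> borel_measurable M"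
    using A by (auto intro!: rep_measurable)
  from countable_essential_INF[OF this]
  obtain T where T: "T \<subseteq> (\<lambda>X \<omega>. - rep X \<omega>) ` A" "countable T"
    "\<forall>g\<in>(\<lambda>X \<omega>. - rep X \<omega>) ` A. AE \<omega> in M. (INF s\<in>T. s \<omega>) \<le> g \<omega>"
    by blast
  have "\<exists>S. countable S \<and> S \<subseteq> A \<and> T = (\<lambda>X \<omega>. - rep X \<omega>) ` S"
    using T(1,2) by (simp add: countable_subset_image[symmetric])
  then obtain S where S: "countable S" "S \<subseteq> A" and TS: "T = (\<lambda>X \<omega>. - rep X \<omega>) ` S"
    by blast
  define s where "s = (\<lambda>\<omega>. SUP X\<in>S. rep X \<omega>)"
  have sm: "s \<in> borel_measurable M"
    unfolding s_def using S A by (intro borel_measurable_SUP rep_measurable) auto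
  define Y where "Y = L0_class M borel s"
  have Y: "Y \<in> L0 M borel" unfolding Y_def by (rule L0_class_in_L0[OF sm])
  have rep_Y: "AE \<omega> in M. rep Y \<omega> = s \<omega>" unfolding Y_def by (rule rep_L0_class[OF sm])
  have "L0_le M X Y" if "X \<in> A" for X
  proof -
    have "(INF g\<in>T. g \<omega>) = - s \<omega>" for \<omega>
      by (simp add: TS image_image s_def ereal_INF_uminus_eq)
    then have "AE \<omega> in M. - s \<omega> \<le> - rep X \<omega>"
      using T(3) that by auto
    with rep_Y show ?thesis
      unfolding L0_le_def by eventually_elim (simp add: ereal_uminus_le_reorder)
  qed
  moreover have "L0_le M Y Z" if Z: "\<And>X. X \<in> A \<Longrightarrow> L0_le M X Z" for Z
  proof -
    have "AE \<omega> in M. \<forall>X\<in>S. rep X \<omega> \<le> rep Z \<omega>"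
      using Z S by (subst AE_ball_countable) (auto simp: L0_le_def)
    with rep_Y show ?thesis
      unfolding L0_le_def by eventually_elim (auto simp: s_def intro: SUP_least)
  qed
  ultimately have "least (L0_bar M) Y (Upper (L0_bar M) A)"
    using Y A by (auto simp: least_def Upper_def L0_bar_def)
  then show ?thesis unfolding sup_def by (rule someI)
qed

text \<open>Pointwise form of the lattice properties. The bound in \<open>Sup_least\<close> is a
  function and not a class, which suits bounds given by a formula in
  \<open>\<omega>\<close>.\<close>

lemma (in finite_measure) L0_bar_Sup:
  assumes A: "A \<subseteq> L0 M borel"
  shows Sup_in_L0: "\<Squnion>\<^bsub>L0_bar M\<^esub> A \<in> L0 M borel"
    and Sup_upper: "X \<in> A \<Longrightarrow> AE \<omega> in M. rep X \<omega> \<le> rep (\<Squnion>\<^bsub>L0_bar M\<^esub> A) \<omega>"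
    and Sup_least: "h \<in> borel_measurable M \<Longrightarrow> (\<And>X. X \<in> A \<Longrightarrow> AE \<omega> in M. rep X \<omega> \<le> h \<omega>) \<Longrightarrow>
      AE \<omega> in M. rep (\<Squnion>\<^bsub>L0_bar M\<^esub> A) \<omega> \<le> h \<omega>"
proof -
  let ?S = "\<Squnion>\<^bsub>L0_bar M\<^esub> A"
  note * = least_Upper_L0_bar[OF A]
  show "?S \<in> L0 M borel" using * by (auto simp: least_def Upper_def L0_bar_def)
  show "AE \<omega> in M. rep X \<omega> \<le> rep ?S \<omega>" if "X \<in> A"
    using * A that by (auto simp: least_def Upper_def L0_bar_def L0_le_def)
  show "AE \<omega> in M. rep ?S \<omega> \<le> h \<omega>"
    if h: "h \<in> borel_measurable M" and le: "\<And>X. X \<in> A \<Longrightarrow> AE \<omega> in M. rep X \<omega> \<le> h \<omega>"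
  proof -
    let ?H = "L0_class M borel h"
    have rep_H: "AE \<omega> in M. rep ?H \<omega> = h \<omega>" by (rule rep_L0_class[OF h])
    have "L0_le M X ?H" if "X \<in> A" for X
      using le[OF that] rep_H unfolding L0_le_def by eventually_elim simp
    then have "?H \<in> Upper (L0_bar M) A"
      using L0_class_in_L0[OF h] by (auto simp: Upper_def L0_bar_def)
    then have "L0_le M ?S ?H" using * by (auto simp: least_def L0_bar_def)
    with rep_H show ?thesis unfolding L0_le_def by eventually_elim simp
  qed
qed

text \<open>For a finite family the null sets can be united, so the lattice supremum is the
  pointwise maximum of representatives; as the family is nonempty, this maximum is attained and
  real.\<close>

lemma (in finite_measure) rep_sup_norm:
  assumes Q: "finite Q" "Q \<noteq> {}" and p: "\<And>p. p \<in> Q \<Longrightarrow> p x \<in> L0 M borel"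
  shows "AE \<omega> in M. rep (sup_norm M Q x) \<omega> = ereal (MAX p\<in>Q. rep (p x) \<omega>)"
proof -
  let ?A = "(\<lambda>p. to_bar M (p x)) ` Q"
  have A: "?A \<subseteq> L0 M borel" using p to_bar_in_L0 by auto
  have bar: "AE \<omega> in M. rep (to_bar M (p x)) \<omega> = ereal (rep (p x) \<omega>)" if "p \<in> Q" for p
    by (rule rep_to_bar[OF p[OF that]])
  have "(\<lambda>\<omega>. MAX p\<in>Q. rep (p x) \<omega>) \<in> borel_measurable M"
    using Q p by (intro borel_measurable_Max rep_measurable) auto
  then have "AE \<omega> in M. rep (\<Squnion>\<^bsub>L0_bar M\<^esub> ?A) \<omega> \<le> ereal (MAX p\<in>Q. rep (p x) \<omega>)"
  proof (intro Sup_least[OF A])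
    fix X assume "X \<in> ?A"
    then obtain r where r: "r \<in> Q" "X = to_bar M (r x)" by blast
    show "AE \<omega> in M. rep X \<omega> \<le> ereal (MAX p\<in>Q. rep (p x) \<omega>)"
      using bar[OF r(1)] unfolding r(2) by eventually_elim (use Q r in auto)
  qed auto
  moreover have "AE \<omega> in M. \<forall>p\<in>Q. ereal (rep (p x) \<omega>) \<le> rep (\<Squnion>\<^bsub>L0_bar M\<^esub> ?A) \<omega>"
  proof (subst AE_ball_countable, use Q in \<open>simp add: countable_finite\<close>, intro ballI)
    fix r assume r: "r \<in> Q"
    then have "AE \<omega> in M. rep (to_bar M (r x)) \<omega> \<le> rep (\<Squnion>\<^bsub>L0_bar M\<^esub> ?A) \<omega>"
      by (intro Sup_upper[OF A]) auto
    with bar[OF r] show "AE \<omega> in M. ereal (rep (r x) \<omega>) \<le> rep (\<Squnion>\<^bsub>L0_bar M\<^esub> ?A) \<omega>"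
      by eventually_elim simp
  qed
  ultimately show ?thesis
    unfolding sup_norm_def
  proof eventually_elim
    case (elim \<omega>)
    have "(MAX p\<in>Q. rep (p x) \<omega>) \<in> (\<lambda>p. rep (p x) \<omega>) ` Q"
      using Q by (intro Max_in) auto
    then show ?case using elim by (intro antisym) auto
  qed
qed

subsection \<open>The scalars\<close>

lemma measurable_scalars_iff:
  "f \<in> measurable M (scalars K) \<longleftrightarrow> f \<in> borel_measurable M \<and> (\<forall>\<omega>\<in>space M. f \<omega> \<in> K)"
  by (auto simp: measurable_restrict_space2_iff)

locale real_or_complex_scalars =
  fixes K :: "complex set"
  assumes real_or_complex: "K = \<real> \<or> K = UNIV"
begin

lemma scalars_closed:
  "of_real r \<in> K" "a \<in> K \<Longrightarrow> b \<in> K \<Longrightarrow> a + b \<in> K" "a \<in> K \<Longrightarrow> b \<in> K \<Longrightarrow> a * b \<in> K"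
  using real_or_complex by auto

lemma measurable_scalars:
  "g \<in> borel_measurable M \<Longrightarrow> (\<lambda>\<omega>. complex_of_real (g \<omega>)) \<in> measurable M (scalars K)"
  "f \<in> measurable M (scalars K) \<Longrightarrow> h \<in> measurable M (scalars K) \<Longrightarrow> (\<lambda>\<omega>. f \<omega> + h \<omega>) \<in> measurable M (scalars K)"
  "f \<in> measurable M (scalars K) \<Longrightarrow> h \<in> measurable M (scalars K) \<Longrightarrow> (\<lambda>\<omega>. f \<omega> * h \<omega>) \<in> measurable M (scalars K)"
  by (auto simp: measurable_scalars_iff scalars_closed)

lemma rep_scalar:
  assumes "X \<in> L0 M (scalars K)"
  shows "rep X \<in> borel_measurable M" "\<omega> \<in> space M \<Longrightarrow> rep X \<omega> \<in> K"
  using rep_measurable[OF assms] by (auto simp: measurable_scalars_iff)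

lemma class_mult:
  assumes "f \<in> measurable M (scalars K)" "g \<in> measurable M (scalars K)"
  shows "L0_class M (scalars K) f \<otimes>\<^bsub>L0_ring M K\<^esub> L0_class M (scalars K) g =
    L0_class M (scalars K) (\<lambda>\<omega>. f \<omega> * g \<omega>)"
  unfolding L0_ring_def
  by simp (intro L0_map2_class assms measurable_scalars rep_measurable L0_class_in_L0)

lemma class_add:
  assumes "f \<in> measurable M (scalars K)" "g \<in> measurable M (scalars K)"
  shows "L0_class M (scalars K) f \<oplus>\<^bsub>L0_ring M K\<^esub> L0_class M (scalars K) g =
    L0_class M (scalars K) (\<lambda>\<omega>. f \<omega> + g \<omega>)"
  unfolding L0_ring_def
  by simp (intro L0_map2_class assms measurable_scalars rep_measurable L0_class_in_L0)

end

section \<open>Topologies given by seminorms\<close>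

text \<open>The real function behind \<open>sup_norm\<close> for a finite nonempty family. All
  estimates are made with it, so that extended reals and lattice suprema drop out of the
  argument.\<close>

definition max_norm :: "('e \<Rightarrow> ('w \<Rightarrow> real) set) set \<Rightarrow> 'e \<Rightarrow> 'w \<Rightarrow> real" where
  "max_norm Q z \<omega> = (MAX p\<in>Q. rep (p z) \<omega>)"

lemma finite_subfamilies_singleton: "p \<in> \<P> \<Longrightarrow> {p} \<in> finite_subfamilies \<P>"
  by (simp add: finite_subfamilies_def)

lemma finite_subfamilies_nonempty: "\<P> \<noteq> {} \<Longrightarrow> finite_subfamilies \<P> \<noteq> {}"
  using finite_subfamilies_singleton by fastforce

lemma finite_subfamilies_Un:
  "Q \<in> finite_subfamilies \<P> \<Longrightarrow> R \<in> finite_subfamilies \<P> \<Longrightarrow> Q \<union> R \<in> finite_subfamilies \<P>"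
  unfolding finite_subfamilies_def by auto

lemma max_norm_Un:
  assumes "Q \<in> finite_subfamilies \<P>" "R \<in> finite_subfamilies \<P>"
  shows "max_norm (Q \<union> R) z \<omega> = max (max_norm Q z \<omega>) (max_norm R z \<omega>)"
  using assms unfolding max_norm_def finite_subfamilies_def image_Un by (intro Max_Un) auto

lemma max_norm_singleton [simp]: "max_norm {p} z \<omega> = rep (p z) \<omega>"
  by (simp add: max_norm_def)

text \<open>Interpreted twice: for \<open>E\<close> with the given seminorms, and for the ring of
  scalars with the modulus. Both sides of the continuity condition thus share one description of
  open sets.\<close>

locale L0_valued_family = finite_measure M + abelian_group G
  for M :: "'w measure" and G :: "('e, 'm) ring_scheme" +
  fixes \<P> :: "('e \<Rightarrow> ('w \<Rightarrow> real) set) set"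
  assumes family_nonempty: "\<P> \<noteq> {}"
    and family_values: "p \<in> \<P> \<Longrightarrow> z \<in> carrier G \<Longrightarrow> p z \<in> L0 M borel"
begin

lemma max_norm_measurable:
  assumes "Q \<in> finite_subfamilies \<P>" "z \<in> carrier G"
  shows "max_norm Q z \<in> borel_measurable M"
  unfolding max_norm_def using assms family_values
  by (intro borel_measurable_Max rep_measurable) (auto simp: finite_subfamilies_def)

lemma rep_sup_norm_eq_max_norm:
  assumes "Q \<in> finite_subfamilies \<P>" "z \<in> carrier G"
  shows "AE \<omega> in M. rep (sup_norm M Q z) \<omega> = ereal (max_norm Q z \<omega>)"
  unfolding max_norm_def using assms family_values
  by (intro rep_sup_norm) (auto simp: finite_subfamilies_def)

lemma sup_norm_in_L0:
  assumes "Q \<in> finite_subfamilies \<P>" "z \<in> carrier G"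
  shows "sup_norm M Q z \<in> L0 M borel"
  unfolding sup_norm_def using assms family_values
  by (intro Sup_in_L0) (auto simp: finite_subfamilies_def intro!: to_bar_in_L0)

lemma measure_sup_norm_less:
  assumes "Q \<in> finite_subfamilies \<P>" "z \<in> carrier G"
  shows "measure M {\<omega> \<in> space M. rep (sup_norm M Q z) \<omega> < ereal \<epsilon>} =
    measure M {\<omega> \<in> space M. max_norm Q z \<omega> < \<epsilon>}"
proof (rule measure_eq_AE)
  show "AE \<omega> in M. \<omega> \<in> {\<omega> \<in> space M. rep (sup_norm M Q z) \<omega> < ereal \<epsilon>} \<longleftrightarrow>
      \<omega> \<in> {\<omega> \<in> space M. max_norm Q z \<omega> < \<epsilon>}"
    using rep_sup_norm_eq_max_norm[OF assms] by eventually_elim simp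
  have [measurable]: "rep (sup_norm M Q z) \<in> borel_measurable M" "max_norm Q z \<in> borel_measurable M"
    using rep_measurable[OF sup_norm_in_L0[OF assms]] max_norm_measurable[OF assms] by auto
  show "{\<omega> \<in> space M. rep (sup_norm M Q z) \<omega> < ereal \<epsilon>} \<in> sets M"
    "{\<omega> \<in> space M. max_norm Q z \<omega> < \<epsilon>} \<in> sets M"
    by measurable
qed

lemma sup_norm_le_iff:
  assumes "Q \<in> finite_subfamilies \<P>" "z \<in> carrier G" "\<epsilon> \<in> L0 M borel"
  shows "L0_le M (sup_norm M Q z) (to_bar M \<epsilon>) \<longleftrightarrow> (AE \<omega> in M. max_norm Q z \<omega> \<le> rep \<epsilon> \<omega>)"
proof
  note * = rep_sup_norm_eq_max_norm[OF assms(1,2)] rep_to_bar[OF assms(3)]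
  assume "L0_le M (sup_norm M Q z) (to_bar M \<epsilon>)"
  then have "AE \<omega> in M. rep (sup_norm M Q z) \<omega> \<le> rep (to_bar M \<epsilon>) \<omega>" by (simp add: L0_le_def)
  with * show "AE \<omega> in M. max_norm Q z \<omega> \<le> rep \<epsilon> \<omega>" by eventually_elim simp
next
  note * = rep_sup_norm_eq_max_norm[OF assms(1,2)] rep_to_bar[OF assms(3)]
  assume "AE \<omega> in M. max_norm Q z \<omega> \<le> rep \<epsilon> \<omega>"
  with * show "L0_le M (sup_norm M Q z) (to_bar M \<epsilon>)" unfolding L0_le_def by eventually_elim simp
qed

text \<open>The description of open sets through a local base is justified once the base is nonempty
  and filtered. Two basic sets are refined by the union of the families together with the smaller
  \<open>\<epsilon>\<close> and \<open>\<delta>\<close>, since the norm of a union is the maximum of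
  the norms.\<close>

lemma openin_eps_lambda_topology:
  "openin (eps_lambda_topology M G \<P>) U \<longleftrightarrow> U \<subseteq> carrier G \<and>
    (\<forall>x\<in>U. \<exists>Q\<in>finite_subfamilies \<P>. \<exists>\<epsilon>>0. \<exists>\<delta>. 0 < \<delta> \<and> \<delta> < 1 \<and>
      (\<forall>z\<in>carrier G. measure M {\<omega> \<in> space M. max_norm Q z \<omega> < \<epsilon>} > 1 - \<delta> \<longrightarrow> x \<oplus>\<^bsub>G\<^esub> z \<in> U))"
proof -
  define V where "V Q \<epsilon> \<delta> = {z \<in> carrier G. measure M {\<omega> \<in> space M. max_norm Q z \<omega> < \<epsilon>} > 1 - \<delta>}"
    for Q \<epsilon> \<delta>
  define \<B> where "\<B> = {V Q \<epsilon> \<delta> | Q \<epsilon> \<delta>. Q \<in> finite_subfamilies \<P> \<and> 0 < \<epsilon> \<and> 0 < \<delta> \<and> \<delta> < 1}"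
  have eq: "{z \<in> carrier G. measure M {\<omega> \<in> space M. rep (sup_norm M Q z) \<omega> < ereal \<epsilon>} > 1 - \<delta>} = V Q \<epsilon> \<delta>"
    if "Q \<in> finite_subfamilies \<P>" for Q \<epsilon> \<delta>
    unfolding V_def using measure_sup_norm_less[OF that] by auto
  have top: "eps_lambda_topology M G \<P> = local_base_topology G \<B>"
    unfolding eps_lambda_topology_def \<B>_def 
    by (intro arg_cong[where f = "local_base_topology G"] Collect_cong ex_cong1 rev_conj_cong) (simp_all add: eq)
  have VB: "V Q \<epsilon> \<delta> \<in> \<B>" if "Q \<in> finite_subfamilies \<P>" "0 < \<epsilon>" "0 < \<delta>" "\<delta> < 1" for Q \<epsilon> \<delta>
    unfolding \<B>_def using that by blast
  have mono: "V Q \<epsilon> \<delta> \<subseteq> V Q' \<epsilon>' \<delta>'"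
    if Q: "Q' \<in> finite_subfamilies \<P>" and le: "\<And>z \<omega>. max_norm Q' z \<omega> \<le> max_norm Q z \<omega>" "\<epsilon> \<le> \<epsilon>'" "\<delta> \<le> \<delta>'" for Q Q' \<epsilon> \<epsilon>' \<delta> \<delta>'
  proof
    fix z assume z: "z \<in> V Q \<epsilon> \<delta>"
    then have zG: "z \<in> carrier G" by (simp add: V_def)
    have [measurable]: "max_norm Q' z \<in> borel_measurable M" by (rule max_norm_measurable[OF Q zG])
    have "measure M {\<omega> \<in> space M. max_norm Q z \<omega> < \<epsilon>} \<le> measure M {\<omega> \<in> space M. max_norm Q' z \<omega> < \<epsilon>'}"
    proof (rule finite_measure_mono)
      show "{\<omega> \<in> space M. max_norm Q z \<omega> < \<epsilon>} \<subseteq> {\<omega> \<in> space M. max_norm Q' z \<omega> < \<epsilon>'}"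
        using le(1)[of z] le(2) by (auto intro: le_less_trans less_le_trans)
    qed measurable
    with z le(3) show "z \<in> V Q' \<epsilon>' \<delta>'" by (simp add: V_def)
  qed
  have open_iff: "openin (local_base_topology G \<B>) U \<longleftrightarrow> U \<subseteq> carrier G \<and> (\<forall>x\<in>U. \<exists>V\<in>\<B>. x <+\<^bsub>G\<^esub> V \<subseteq> U)"
  proof (rule openin_local_base_topology)
    obtain Q where "Q \<in> finite_subfamilies \<P>"
      using finite_subfamilies_nonempty[OF family_nonempty] by blast
    from VB[OF this, of 1 "1/2"] show "\<B> \<noteq> {}" by auto
    fix S T assume "S \<in> \<B>" "T \<in> \<B>"
    then obtain Q \<epsilon> \<delta> R \<epsilon>' \<delta>' where S: "S = V Q \<epsilon> \<delta>" "Q \<in> finite_subfamilies \<P>" "0 < \<epsilon>" "0 < \<delta>" "\<delta> < 1"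
      and T: "T = V R \<epsilon>' \<delta>'" "R \<in> finite_subfamilies \<P>" "0 < \<epsilon>'" "0 < \<delta>'" "\<delta>' < 1"
      unfolding \<B>_def by blast
    have "V (Q \<union> R) (min \<epsilon> \<epsilon>') (min \<delta> \<delta>') \<subseteq> S \<inter> T"
      unfolding S(1) T(1) using S(2) T(2) by (intro Int_greatest mono) (simp_all add: max_norm_Un)
    moreover have "V (Q \<union> R) (min \<epsilon> \<epsilon>') (min \<delta> \<delta>') \<in> \<B>"
      using S T by (intro VB finite_subfamilies_Un) auto
    ultimately show "\<exists>U\<in>\<B>. U \<subseteq> S \<inter> T" by blast
  qed
  have base: "(\<exists>V\<in>\<B>. x <+\<^bsub>G\<^esub> V \<subseteq> U) \<longleftrightarrow> (\<exists>Q\<in>finite_subfamilies \<P>. \<exists>\<epsilon>>0. \<exists>\<delta>. 0 < \<delta> \<and> \<delta> < 1 \<and>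
      (\<forall>z\<in>carrier G. measure M {\<omega> \<in> space M. max_norm Q z \<omega> < \<epsilon>} > 1 - \<delta> \<longrightarrow> x \<oplus>\<^bsub>G\<^esub> z \<in> U))" for x
  proof -
    have "x <+\<^bsub>G\<^esub> V Q \<epsilon> \<delta> \<subseteq> U \<longleftrightarrow>
      (\<forall>z\<in>carrier G. measure M {\<omega> \<in> space M. max_norm Q z \<omega> < \<epsilon>} > 1 - \<delta> \<longrightarrow> x \<oplus>\<^bsub>G\<^esub> z \<in> U)" for Q \<epsilon> \<delta>
      by (auto simp: a_l_coset_def' V_def)
    then show ?thesis unfolding \<B>_def by blast
  qed
  show ?thesis unfolding top open_iff base by (rule refl)
qed

lemma L0_pplusD:
  assumes "\<epsilon> \<in> L0_pplus M"
  shows "\<epsilon> \<in> L0 M borel" "AE \<omega> in M. 0 < rep \<epsilon> \<omega>"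
proof -
  show "\<epsilon> \<in> L0 M borel" using assms by (simp add: L0_pplus_def)
  have "AE \<omega> in M. rep (L0_zero M :: ('w \<Rightarrow> real) set) \<omega> = 0" by (rule rep_L0_class) simp
  moreover have "AE \<omega> in M. \<omega> \<in> space M \<longrightarrow> rep (L0_zero M) \<omega> < rep \<epsilon> \<omega>"
    using assms by (simp add: L0_pplus_def gt_on_def)
  moreover have "AE \<omega> in M. \<omega> \<in> space M" by simp
  ultimately show "AE \<omega> in M. 0 < rep \<epsilon> \<omega>" by eventually_elim simp
qed

lemma L0_pplusI:
  assumes g: "g \<in> borel_measurable M" and pos: "AE \<omega> in M. 0 < g \<omega>"
  shows "L0_class M borel g \<in> L0_pplus M"
proof -
  have "AE \<omega> in M. rep (L0_zero M :: ('w \<Rightarrow> real) set) \<omega> = 0" by (rule rep_L0_class) simp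
  with rep_L0_class[OF g] pos
  have "AE \<omega> in M. \<omega> \<in> space M \<longrightarrow> rep (L0_zero M) \<omega> < rep (L0_class M borel g) \<omega>"
    by eventually_elim simp
  then show ?thesis using L0_class_in_L0[OF g] by (simp add: L0_pplus_def gt_on_def)
qed

text \<open>The radii are now random, and the common refinement uses their pointwise minimum, which
  is again positive almost everywhere.\<close>

lemma openin_L0_convex_topology:
  "openin (L0_convex_topology M G \<P>) U \<longleftrightarrow> U \<subseteq> carrier G \<and>
    (\<forall>x\<in>U. \<exists>Q\<in>finite_subfamilies \<P>. \<exists>\<epsilon>\<in>L0_pplus M.
      \<forall>z\<in>carrier G. (AE \<omega> in M. max_norm Q z \<omega> \<le> rep \<epsilon> \<omega>) \<longrightarrow> x \<oplus>\<^bsub>G\<^esub> z \<in> U)"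
proof -
  define V where "V Q \<epsilon> = {z \<in> carrier G. AE \<omega> in M. max_norm Q z \<omega> \<le> rep \<epsilon> \<omega>}" for Q and \<epsilon> :: "('w \<Rightarrow> real) set"
  define \<B> where "\<B> = {V Q \<epsilon> | Q \<epsilon>. Q \<in> finite_subfamilies \<P> \<and> \<epsilon> \<in> L0_pplus M}"
  have eq: "{z \<in> carrier G. L0_le M (sup_norm M Q z) (to_bar M \<epsilon>)} = V Q \<epsilon>"
    if "Q \<in> finite_subfamilies \<P>" "\<epsilon> \<in> L0_pplus M" for Q \<epsilon>
    unfolding V_def using sup_norm_le_iff[OF that(1) _ L0_pplusD(1)[OF that(2)]] by auto
  have top: "L0_convex_topology M G \<P> = local_base_topology G \<B>"
    unfolding L0_convex_topology_def \<B>_def 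
    by (intro arg_cong[where f = "local_base_topology G"] Collect_cong ex_cong1 rev_conj_cong) (simp_all add: eq)
  have VB: "V Q \<epsilon> \<in> \<B>" if "Q \<in> finite_subfamilies \<P>" "\<epsilon> \<in> L0_pplus M" for Q \<epsilon>
    unfolding \<B>_def using that by blast
  have open_iff: "openin (local_base_topology G \<B>) U \<longleftrightarrow> U \<subseteq> carrier G \<and> (\<forall>x\<in>U. \<exists>V\<in>\<B>. x <+\<^bsub>G\<^esub> V \<subseteq> U)"
  proof (rule openin_local_base_topology)
    obtain Q where "Q \<in> finite_subfamilies \<P>"
      using finite_subfamilies_nonempty[OF family_nonempty] by blast
    from VB[OF this L0_pplusI[of "\<lambda>_. 1"]] show "\<B> \<noteq> {}" by auto
    fix S T assume "S \<in> \<B>" "T \<in> \<B>"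
    then obtain Q \<epsilon> R \<epsilon>' where S: "S = V Q \<epsilon>" "Q \<in> finite_subfamilies \<P>" "\<epsilon> \<in> L0_pplus M"
      and T: "T = V R \<epsilon>'" "R \<in> finite_subfamilies \<P>" "\<epsilon>' \<in> L0_pplus M"
      unfolding \<B>_def by blast
    define m where "m = (\<lambda>\<omega>. min (rep \<epsilon> \<omega>) (rep \<epsilon>' \<omega>))"
    have m: "m \<in> borel_measurable M"
      unfolding m_def by (intro borel_measurable_min rep_measurable L0_pplusD(1) S(3) T(3))
    have "AE \<omega> in M. 0 < m \<omega>"
      using L0_pplusD(2)[OF S(3)] L0_pplusD(2)[OF T(3)] by eventually_elim (simp add: m_def)
    then have mp: "L0_class M borel m \<in> L0_pplus M" by (rule L0_pplusI[OF m])
    have "z \<in> S \<inter> T" if z: "z \<in> V (Q \<union> R) (L0_class M borel m)" for z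
    proof -
      have "AE \<omega> in M. max_norm (Q \<union> R) z \<omega> \<le> rep (L0_class M borel m) \<omega>" using z by (simp add: V_def)
      with rep_L0_class[OF m] have "AE \<omega> in M. max_norm Q z \<omega> \<le> rep \<epsilon> \<omega> \<and> max_norm R z \<omega> \<le> rep \<epsilon>' \<omega>"
        by eventually_elim (simp add: max_norm_Un[OF S(2) T(2)] m_def)
      with z show ?thesis by (simp add: S(1) T(1) V_def)
    qed
    with VB[OF finite_subfamilies_Un[OF S(2) T(2)] mp] show "\<exists>U\<in>\<B>. U \<subseteq> S \<inter> T" by blast
  qed
  have base: "(\<exists>V\<in>\<B>. x <+\<^bsub>G\<^esub> V \<subseteq> U) \<longleftrightarrow> (\<exists>Q\<in>finite_subfamilies \<P>. \<exists>\<epsilon>\<in>L0_pplus M.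
      \<forall>z\<in>carrier G. (AE \<omega> in M. max_norm Q z \<omega> \<le> rep \<epsilon> \<omega>) \<longrightarrow> x \<oplus>\<^bsub>G\<^esub> z \<in> U)" for x
  proof -
    have "x <+\<^bsub>G\<^esub> V Q \<epsilon> \<subseteq> U \<longleftrightarrow>
      (\<forall>z\<in>carrier G. (AE \<omega> in M. max_norm Q z \<omega> \<le> rep \<epsilon> \<omega>) \<longrightarrow> x \<oplus>\<^bsub>G\<^esub> z \<in> U)" for Q \<epsilon>
      by (auto simp: a_l_coset_def' V_def)
    then show ?thesis unfolding \<B>_def by blast
  qed
  show ?thesis unfolding top open_iff base by (rule refl)
qed

lemma topspace_eps_lambda_topology: "topspace (eps_lambda_topology M G \<P>) = carrier G"
proof (rule antisym)
  show "topspace (eps_lambda_topology M G \<P>) \<subseteq> carrier G"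
    using openin_topspace[of "eps_lambda_topology M G \<P>"] unfolding openin_eps_lambda_topology by blast
  obtain Q where Q: "Q \<in> finite_subfamilies \<P>"
    using finite_subfamilies_nonempty[OF family_nonempty] by blast
  have "openin (eps_lambda_topology M G \<P>) (carrier G)"
    unfolding openin_eps_lambda_topology
    by (intro conjI ballI bexI[OF _ Q] exI[of _ 1] exI[of _ "1/2"]) auto
  then show "carrier G \<subseteq> topspace (eps_lambda_topology M G \<P>)" by (rule openin_subset)
qed

lemma topspace_L0_convex_topology: "topspace (L0_convex_topology M G \<P>) = carrier G"
proof (rule antisym)
  show "topspace (L0_convex_topology M G \<P>) \<subseteq> carrier G"
    using openin_topspace[of "L0_convex_topology M G \<P>"] unfolding openin_L0_convex_topology by blast
  obtain Q where Q: "Q \<in> finite_subfamilies \<P>"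
    using finite_subfamilies_nonempty[OF family_nonempty] by blast
  have "openin (L0_convex_topology M G \<P>) (carrier G)"
    unfolding openin_L0_convex_topology
    by (intro conjI ballI bexI[OF _ Q] bexI[OF _ L0_pplusI[of "\<lambda>_. 1"]]) auto
  then show "carrier G \<subseteq> topspace (L0_convex_topology M G \<P>)" by (rule openin_subset)
qed

end

section \<open>Random locally convex modules\<close>

context random_locally_convex_module
begin

sublocale scalars: real_or_complex_scalars K
  by unfold_locales (rule scalar_field)

lemma carrier_L0_ring: "carrier (L0_ring M K) = L0 M (scalars K)"
  by (simp add: L0_ring_def)

lemma class_in_carrier: "f \<in> measurable M (scalars K) \<Longrightarrow> L0_class M (scalars K) f \<in> carrier (L0_ring M K)"
  by (simp add: carrier_L0_ring L0_class_in_L0)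

lemma seminorm_in_L0_plus: "p \<in> \<P> \<Longrightarrow> z \<in> carrier E \<Longrightarrow> p z \<in> L0_plus M"
  using seminorms[of p] unfolding L0_seminorm_def by blast

lemma seminorm_in_L0: "p \<in> \<P> \<Longrightarrow> z \<in> carrier E \<Longrightarrow> p z \<in> L0 M borel"
  using seminorm_in_L0_plus by (auto simp: L0_plus_def)

lemma seminorms_nonempty: "\<P> \<noteq> {}"
proof
  assume "\<P> = {}"
  moreover have "sup_norm M \<P> \<zero>\<^bsub>E\<^esub> = L0_zero M"
    using separating[of "\<zero>\<^bsub>E\<^esub>"] by simp
  ultimately have sup: "\<Squnion>\<^bsub>L0_bar M\<^esub> {} = (L0_zero M :: ('w \<Rightarrow> ereal) set)"
    by (simp add: sup_norm_def)
  have "AE \<omega> in M. rep (\<Squnion>\<^bsub>L0_bar M\<^esub> {}) \<omega> \<le> (-\<infinity> :: ereal)"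
    by (rule Sup_least) auto
  then have "AE \<omega> in M. rep (L0_zero M) \<omega> \<le> (-\<infinity> :: ereal)"
    by (simp only: sup)
  moreover have "AE \<omega> in M. rep (L0_zero M) \<omega> = (0 :: ereal)"
    by (rule rep_L0_class) simp
  ultimately have "AE \<omega> in M. False"
    by eventually_elim simp
  then show False by simp
qed

sublocale L0_valued_family M E \<P>
  by unfold_locales (use seminorms_nonempty seminorm_in_L0 in auto)

section \<open>Pointwise laws of the seminorms and their finite maxima\<close>

lemma rep_L0_abs:
  assumes "\<xi> \<in> L0 M (scalars K)"
  shows "AE \<omega> in M. rep (L0_abs M \<xi>) \<omega> = cmod (rep \<xi> \<omega>)" "L0_abs M \<xi> \<in> L0 M borel"
proof -
  have "(\<lambda>\<omega>. cmod (rep \<xi> \<omega>)) \<in> borel_measurable M"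
    using scalars.rep_scalar(1)[OF assms] by simp
  then show "AE \<omega> in M. rep (L0_abs M \<xi>) \<omega> = cmod (rep \<xi> \<omega>)" "L0_abs M \<xi> \<in> L0 M borel"
    unfolding L0_abs_def L0_map_def by (rule rep_L0_class, rule L0_class_in_L0)
qed

lemma seminorm_nonneg:
  assumes "p \<in> \<P>" "z \<in> carrier E"
  shows "AE \<omega> in M. 0 \<le> rep (p z) \<omega>"
proof -
  have "AE \<omega> in M. rep (L0_zero M :: ('w \<Rightarrow> real) set) \<omega> = 0" by (rule rep_L0_class) simp
  moreover have "AE \<omega> in M. rep (L0_zero M) \<omega> \<le> rep (p z) \<omega>"
    using seminorm_in_L0_plus[OF assms] by (simp add: L0_plus_def L0_le_def)
  ultimately show ?thesis by eventually_elim simp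
qed

lemma seminorm_smult:
  assumes p: "p \<in> \<P>" and \<xi>: "\<xi> \<in> L0 M (scalars K)" and z: "z \<in> carrier E"
  shows "AE \<omega> in M. rep (p (\<xi> \<odot>\<^bsub>E\<^esub> z)) \<omega> = cmod (rep \<xi> \<omega>) * rep (p z) \<omega>"
proof -
  have "p (\<xi> \<odot>\<^bsub>E\<^esub> z) = L0_map2 M borel (*) (L0_abs M \<xi>) (p z)"
    using seminorms[OF p] \<xi> z by (simp add: L0_seminorm_def carrier_L0_ring)
  moreover have "AE \<omega> in M. rep (L0_map2 M borel (*) (L0_abs M \<xi>) (p z)) \<omega> =
      rep (L0_abs M \<xi>) \<omega> * rep (p z) \<omega>"
    unfolding L0_map2_def
    by (intro rep_L0_class borel_measurable_times rep_measurable rep_L0_abs(2) \<xi> seminorm_in_L0[OF p z])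
  ultimately have "AE \<omega> in M. rep (p (\<xi> \<odot>\<^bsub>E\<^esub> z)) \<omega> = rep (L0_abs M \<xi>) \<omega> * rep (p z) \<omega>" by simp
  with rep_L0_abs(1)[OF \<xi>] show ?thesis by eventually_elim simp
qed

lemma seminorm_add:
  assumes p: "p \<in> \<P>" and z: "z \<in> carrier E" and w: "w \<in> carrier E"
  shows "AE \<omega> in M. rep (p (z \<oplus>\<^bsub>E\<^esub> w)) \<omega> \<le> rep (p z) \<omega> + rep (p w) \<omega>"
proof -
  have "AE \<omega> in M. rep (p (z \<oplus>\<^bsub>E\<^esub> w)) \<omega> \<le> rep (L0_map2 M borel (+) (p z) (p w)) \<omega>"
    using seminorms[OF p] z w by (simp add: L0_seminorm_def L0_le_def)
  moreover have "AE \<omega> in M. rep (L0_map2 M borel (+) (p z) (p w)) \<omega> = rep (p z) \<omega> + rep (p w) \<omega>"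
    unfolding L0_map2_def
    by (intro rep_L0_class borel_measurable_add rep_measurable seminorm_in_L0 p z w)
  ultimately show ?thesis by eventually_elim simp
qed

lemma AE_finite_subfamily:
  assumes "Q \<in> finite_subfamilies \<P>" "\<And>p. p \<in> \<P> \<Longrightarrow> AE \<omega> in M. A p \<omega>"
  shows "AE \<omega> in M. \<forall>p\<in>Q. A p \<omega>"
  using assms by (subst AE_ball_countable) (auto simp: finite_subfamilies_def countable_finite)

lemma le_max_norm: "Q \<in> finite_subfamilies \<P> \<Longrightarrow> p \<in> Q \<Longrightarrow> rep (p z) \<omega> \<le> max_norm Q z \<omega>"
  unfolding max_norm_def finite_subfamilies_def by (auto intro: Max_ge)

lemma max_norm_le_iff:
  "Q \<in> finite_subfamilies \<P> \<Longrightarrow> max_norm Q z \<omega> \<le> c \<longleftrightarrow> (\<forall>p\<in>Q. rep (p z) \<omega> \<le> c)"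
  unfolding max_norm_def finite_subfamilies_def by (subst Max_le_iff) auto

lemma max_norm_nonneg:
  assumes Q: "Q \<in> finite_subfamilies \<P>" and z: "z \<in> carrier E"
  shows "AE \<omega> in M. 0 \<le> max_norm Q z \<omega>"
proof -
  obtain p where p: "p \<in> Q" using Q by (auto simp: finite_subfamilies_def)
  then have "p \<in> \<P>" using Q by (auto simp: finite_subfamilies_def)
  from seminorm_nonneg[OF this z] show ?thesis
    by eventually_elim (rule order_trans[OF _ le_max_norm[OF Q p]])
qed

lemma max_norm_add:
  assumes Q: "Q \<in> finite_subfamilies \<P>" and z: "z \<in> carrier E" "w \<in> carrier E"
  shows "AE \<omega> in M. max_norm Q (z \<oplus>\<^bsub>E\<^esub> w) \<omega> \<le> max_norm Q z \<omega> + max_norm Q w \<omega>"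
proof -
  have "AE \<omega> in M. \<forall>p\<in>Q. rep (p (z \<oplus>\<^bsub>E\<^esub> w)) \<omega> \<le> rep (p z) \<omega> + rep (p w) \<omega>"
    by (rule AE_finite_subfamily[OF Q]) (rule seminorm_add[OF _ z])
  then show ?thesis
  proof eventually_elim
    case (elim \<omega>)
    have "rep (p (z \<oplus>\<^bsub>E\<^esub> w)) \<omega> \<le> max_norm Q z \<omega> + max_norm Q w \<omega>" if p: "p \<in> Q" for p
      using elim p le_max_norm[OF Q p, of z \<omega>] le_max_norm[OF Q p, of w \<omega>] by fastforce
    then show ?case using max_norm_le_iff[OF Q] by blast
  qed
qed

text \<open>Multiplication by the nonnegative number \<open>cmod (rep \<xi> \<omega>)\<close> is
  monotone and therefore commutes with a finite maximum.\<close>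

lemma max_norm_smult:
  assumes Q: "Q \<in> finite_subfamilies \<P>" and \<xi>: "\<xi> \<in> L0 M (scalars K)" and z: "z \<in> carrier E"
  shows "AE \<omega> in M. max_norm Q (\<xi> \<odot>\<^bsub>E\<^esub> z) \<omega> = cmod (rep \<xi> \<omega>) * max_norm Q z \<omega>"
proof -
  have "AE \<omega> in M. \<forall>p\<in>Q. rep (p (\<xi> \<odot>\<^bsub>E\<^esub> z)) \<omega> = cmod (rep \<xi> \<omega>) * rep (p z) \<omega>"
    by (rule AE_finite_subfamily[OF Q]) (rule seminorm_smult[OF _ \<xi> z])
  then show ?thesis
  proof eventually_elim
    case (elim \<omega>)
    have "cmod (rep \<xi> \<omega>) * (MAX p\<in>Q. rep (p z) \<omega>) = Max ((*) (cmod (rep \<xi> \<omega>)) ` (\<lambda>p. rep (p z) \<omega>) ` Q)"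
      using Q by (intro mono_Max_commute) (auto simp: finite_subfamilies_def intro!: monoI mult_left_mono)
    also have "(*) (cmod (rep \<xi> \<omega>)) ` (\<lambda>p. rep (p z) \<omega>) ` Q = (\<lambda>p. rep (p (\<xi> \<odot>\<^bsub>E\<^esub> z)) \<omega>) ` Q"
      unfolding image_image using elim by (intro image_cong) auto
    finally show ?case by (simp add: max_norm_def)
  qed
qed

text \<open>Both choices of \<open>K\<close> contain the reals, so \<open>E\<close> always carries
  this action, and the real Hahn-Banach theorem applies to the underlying real structure.\<close>

definition real_act :: "('w \<Rightarrow> real) \<Rightarrow> 'e \<Rightarrow> 'e" where
  "real_act a z = L0_class M (scalars K) (\<lambda>\<omega>. complex_of_real (a \<omega>)) \<odot>\<^bsub>E\<^esub> z"

sublocale real_function_module M E real_act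
proof unfold_locales
  fix a b :: "'w \<Rightarrow> real" and z w assume a: "a \<in> borel_measurable M" and z: "z \<in> carrier E"
  note am = scalars.measurable_scalars(1)[OF a]
  show "real_act a z \<in> carrier E"
    unfolding real_act_def by (intro smult_closed class_in_carrier am z)
  show "real_act a (z \<oplus>\<^bsub>E\<^esub> w) = real_act a z \<oplus>\<^bsub>E\<^esub> real_act a w" if "w \<in> carrier E"
    unfolding real_act_def by (intro smult_r_distr class_in_carrier am z that)
  assume b: "b \<in> borel_measurable M"
  note bm = scalars.measurable_scalars(1)[OF b]
  show "real_act (\<lambda>\<omega>. a \<omega> + b \<omega>) z = real_act a z \<oplus>\<^bsub>E\<^esub> real_act b z"
    unfolding real_act_def
    by (subst smult_l_distr[symmetric, OF class_in_carrier[OF am] class_in_carrier[OF bm] z])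
       (simp add: scalars.class_add[OF am bm])
  show "real_act (\<lambda>\<omega>. a \<omega> * b \<omega>) z = real_act a (real_act b z)"
    unfolding real_act_def
    by (subst smult_assoc1[symmetric, OF class_in_carrier[OF am] class_in_carrier[OF bm] z])
       (simp add: scalars.class_mult[OF am bm])
next
  fix z assume "z \<in> carrier E"
  then have "\<one>\<^bsub>L0_ring M K\<^esub> \<odot>\<^bsub>E\<^esub> z = z" by (rule smult_one)
  then show "real_act (\<lambda>_. 1) z = z"
    by (simp add: real_act_def L0_ring_def)
qed

lemma max_norm_real_act:
  assumes Q: "Q \<in> finite_subfamilies \<P>" and a: "a \<in> borel_measurable M" and z: "z \<in> carrier E"
  shows "AE \<omega> in M. max_norm Q (real_act a z) \<omega> = \<bar>a \<omega>\<bar> * max_norm Q z \<omega>"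
proof -
  note am = scalars.measurable_scalars(1)[OF a]
  from max_norm_smult[OF Q L0_class_in_L0[OF am] z] rep_L0_class[OF am]
  show ?thesis unfolding real_act_def by eventually_elim simp
qed

lemma sublinear_max_norm:
  assumes Q: "Q \<in> finite_subfamilies \<P>"
  shows "sublinear (max_norm Q)"
  unfolding sublinear_def
proof (intro conjI ballI impI)
  show "max_norm Q z \<in> borel_measurable M" if "z \<in> carrier E" for z
    by (rule max_norm_measurable[OF Q that])
  show "AE \<omega> in M. max_norm Q (z \<oplus>\<^bsub>E\<^esub> w) \<omega> \<le> max_norm Q z \<omega> + max_norm Q w \<omega>"
    if "z \<in> carrier E" "w \<in> carrier E" for z w
    by (rule max_norm_add[OF Q that])
  show "AE \<omega> in M. max_norm Q (real_act a z) \<omega> \<le> a \<omega> * max_norm Q z \<omega>"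
    if "a \<in> borel_measurable M" "z \<in> carrier E" "\<forall>\<omega>. 0 \<le> a \<omega>" for a z
    using max_norm_real_act[OF Q that(1,2)] by eventually_elim (use that(3) in simp)
qed

lemma max_norm_minus:
  assumes Q: "Q \<in> finite_subfamilies \<P>" and z: "z \<in> carrier E"
  shows "AE \<omega> in M. max_norm Q (\<ominus>\<^bsub>E\<^esub> z) \<omega> = max_norm Q z \<omega>"
  using max_norm_real_act[OF Q _ z, of "\<lambda>_. -1"] by (simp add: act_minus_one[OF z])

text \<open>Passes from convexity over classes to coefficients that are functions with values in the
  unit interval, in particular to indicator functions, which glue two points of
  \<open>C\<close>.\<close>

lemma L0_convex_act:
  assumes C: "L0_convex M K E C" "C \<subseteq> carrier E" and y: "y \<in> C" "y' \<in> C"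
    and \<xi>: "\<xi> \<in> borel_measurable M" "\<And>\<omega>. 0 \<le> \<xi> \<omega> \<and> \<xi> \<omega> \<le> 1"
  shows "real_act \<xi> y \<oplus>\<^bsub>E\<^esub> real_act (\<lambda>\<omega>. 1 - \<xi> \<omega>) y' \<in> C"
proof -
  let ?X = "L0_class M borel \<xi>"
  let ?c = "\<lambda>a. L0_class M (scalars K) (\<lambda>\<omega>. complex_of_real (a \<omega>))"
  have X: "?X \<in> L0 M borel" by (rule L0_class_in_L0[OF \<xi>(1)])
  have r: "AE \<omega> in M. rep ?X \<omega> = \<xi> \<omega>" by (rule rep_L0_class[OF \<xi>(1)])
  have r0: "AE \<omega> in M. rep (L0_zero M :: ('w \<Rightarrow> real) set) \<omega> = 0" by (rule rep_L0_class) simp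
  have r1: "AE \<omega> in M. rep (L0_one M) \<omega> = 1" by (rule rep_L0_class) simp
  from r r0 have "L0_le M (L0_zero M) ?X" unfolding L0_le_def by eventually_elim (use \<xi>(2) in simp)
  moreover from r r1 have "L0_le M ?X (L0_one M)" unfolding L0_le_def by eventually_elim (use \<xi>(2) in simp)
  ultimately have "(L0_of_real M K ?X \<odot>\<^bsub>E\<^esub> y) \<oplus>\<^bsub>E\<^esub>
      ((\<one>\<^bsub>L0_ring M K\<^esub> \<ominus>\<^bsub>L0_ring M K\<^esub> L0_of_real M K ?X) \<odot>\<^bsub>E\<^esub> y') \<in> C"
    using C(1) y X by (simp add: L0_convex_def L0_plus_def)
  moreover have of_real: "L0_of_real M K ?X = ?c \<xi>"
    unfolding L0_of_real_def
    by (intro L0_map_class scalars.measurable_scalars \<xi> rep_measurable X)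
  \<comment> \<open>Ring subtraction goes through an abstract additive inverse. Its class need not
    be computed: the candidate for the difference is recognised by adding the class of
    \<open>\<xi>\<close> back to it.\<close>
  moreover have "\<one>\<^bsub>L0_ring M K\<^esub> \<ominus>\<^bsub>L0_ring M K\<^esub> ?c \<xi> = ?c (\<lambda>\<omega>. 1 - \<xi> \<omega>)"
  proof -
    note m = scalars.measurable_scalars(1)[where M = M]
    have m1: "(\<lambda>\<omega>. 1 - \<xi> \<omega>) \<in> borel_measurable M" using \<xi>(1) by simp
    have "?c (\<lambda>\<omega>. 1 - \<xi> \<omega>) \<oplus>\<^bsub>L0_ring M K\<^esub> ?c \<xi> = L0_class M (scalars K) (\<lambda>\<omega>. 1)"
      using scalars.class_add[OF m[OF m1] m[OF \<xi>(1)]] by simp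
    also have "\<dots> = \<one>\<^bsub>L0_ring M K\<^esub>" by (simp add: L0_ring_def)
    finally have e: "?c (\<lambda>\<omega>. 1 - \<xi> \<omega>) \<oplus>\<^bsub>L0_ring M K\<^esub> ?c \<xi> = \<one>\<^bsub>L0_ring M K\<^esub>" .
    note cl = class_in_carrier[OF m[OF m1]] class_in_carrier[OF m[OF \<xi>(1)]]
    show ?thesis unfolding e[symmetric] a_minus_def
      using cl by (simp add: R.a_assoc R.r_neg)
  qed
  ultimately show ?thesis by (simp add: real_act_def)
qed

text \<open>Splitting \<open>x\<close> with the same two weights shows that reflection and
  translation by \<open>x\<close> preserve convex combinations. This gives both the norm of a glued
  difference and the convexity of the set of differences.\<close>

lemma minus_add_combination:
  assumes x: "x \<in> carrier E" and y: "y \<in> carrier E" "y' \<in> carrier E" and \<xi>: "\<xi> \<in> borel_measurable M"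
  shows "x \<ominus>\<^bsub>E\<^esub> (real_act \<xi> y \<oplus>\<^bsub>E\<^esub> real_act (\<lambda>\<omega>. 1 - \<xi> \<omega>) y') =
    real_act \<xi> (x \<ominus>\<^bsub>E\<^esub> y) \<oplus>\<^bsub>E\<^esub> real_act (\<lambda>\<omega>. 1 - \<xi> \<omega>) (x \<ominus>\<^bsub>E\<^esub> y')"
proof -
  let ?\<eta> = "\<lambda>\<omega>. 1 - \<xi> \<omega>"
  have \<eta>: "?\<eta> \<in> borel_measurable M" using \<xi> by simp
  note cl = act_closed[OF \<xi> x] act_closed[OF \<eta> x] act_closed[OF \<xi> y(1)] act_closed[OF \<eta> y(2)]
  have "x = real_act \<xi> x \<oplus>\<^bsub>E\<^esub> real_act ?\<eta> x"
    using act_plus[OF \<xi> \<eta> x] by (simp add: act_one x)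
  then have "x \<ominus>\<^bsub>E\<^esub> (real_act \<xi> y \<oplus>\<^bsub>E\<^esub> real_act ?\<eta> y') =
      (real_act \<xi> x \<oplus>\<^bsub>E\<^esub> real_act ?\<eta> x) \<ominus>\<^bsub>E\<^esub> (real_act \<xi> y \<oplus>\<^bsub>E\<^esub> real_act ?\<eta> y')"
    by simp
  also have "\<dots> = (real_act \<xi> x \<oplus>\<^bsub>E\<^esub> \<ominus>\<^bsub>E\<^esub> real_act \<xi> y) \<oplus>\<^bsub>E\<^esub> (real_act ?\<eta> x \<oplus>\<^bsub>E\<^esub> \<ominus>\<^bsub>E\<^esub> real_act ?\<eta> y')"
    using cl by (simp add: M.minus_add M.a_ac a_minus_def)
  also have "\<dots> = real_act \<xi> (x \<ominus>\<^bsub>E\<^esub> y) \<oplus>\<^bsub>E\<^esub> real_act ?\<eta> (x \<ominus>\<^bsub>E\<^esub> y')"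
    using x y by (simp add: a_minus_def act_add[OF \<xi>] act_add[OF \<eta>] act_minus(2)[OF \<xi>] act_minus(2)[OF \<eta>])
  finally show ?thesis .
qed

text \<open>
  Gluing by indicator functions makes the sets on which some \<open>y \<in> C\<close> is within \<open>\<epsilon>\<close> of \<open>x\<close> directed,
  so closedness bounds the probability of their essential union away from one. Outside of that
  union all of \<open>C\<close> keeps distance \<open>\<epsilon>\<close>.
\<close>
lemma distance_from_closed:
  assumes x: "x \<in> carrier E" "x \<notin> C" and C: "C \<subseteq> carrier E" "L0_convex M K E C"
    and closed: "closedin (eps_lambda_topology M E \<P>) C"
  shows "\<exists>Q\<in>finite_subfamilies \<P>. \<exists>\<epsilon>>0. \<exists>B\<in>sets M. measure M B > 0 \<and>
    (\<forall>y\<in>C. AE \<omega> in M. \<omega> \<in> B \<longrightarrow> \<epsilon> \<le> max_norm Q (x \<ominus>\<^bsub>E\<^esub> y) \<omega>)"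
proof -
  have "openin (eps_lambda_topology M E \<P>) (carrier E - C)"
    using closed by (simp add: closedin_def topspace_eps_lambda_topology)
  then have "\<exists>Q\<in>finite_subfamilies \<P>. \<exists>\<epsilon>>0. \<exists>\<delta>. 0 < \<delta> \<and> \<delta> < 1 \<and>
      (\<forall>z\<in>carrier E. measure M {\<omega> \<in> space M. max_norm Q z \<omega> < \<epsilon>} > 1 - \<delta> \<longrightarrow> x \<oplus>\<^bsub>E\<^esub> z \<in> carrier E - C)"
    unfolding openin_eps_lambda_topology by (elim conjE bspec) (use x in simp)
  then obtain Q \<epsilon> \<delta> where Q: "Q \<in> finite_subfamilies \<P>" and \<epsilon>: "0 < \<epsilon>" and \<delta>: "0 < \<delta>" "\<delta> < 1"
    and far: "\<And>z. z \<in> carrier E \<Longrightarrow> measure M {\<omega> \<in> space M. max_norm Q z \<omega> < \<epsilon>} > 1 - \<delta> \<Longrightarrow>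
      x \<oplus>\<^bsub>E\<^esub> z \<in> carrier E - C"
    by blast
  have xy: "x \<ominus>\<^bsub>E\<^esub> y \<in> carrier E" if "y \<in> C" for y
    using x C that by auto
  define N where "N y = max_norm Q (x \<ominus>\<^bsub>E\<^esub> y)" for y
  have Nm: "N y \<in> borel_measurable M" if "y \<in> C" for y
    unfolding N_def by (rule max_norm_measurable[OF Q xy[OF that]])
  define S where "S y = {\<omega> \<in> space M. N y \<omega> < \<epsilon>}" for y
  have Sm: "S y \<in> sets M" if "y \<in> C" for y
    unfolding S_def using Nm[OF that] by measurable
  have bound: "measure M (S y) \<le> 1 - \<delta>" if y: "y \<in> C" for y
  proof (rule ccontr)
    assume "\<not> ?thesis"
    \<comment> \<open>Neighbourhoods of \<open>x\<close> are written \<open>x + z\<close>, so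
      reaching \<open>y\<close> requires the negative of \<open>x - y\<close>; the norm is even,
      hence the set where it is small changes only by a null set.\<close>
    let ?z = "\<ominus>\<^bsub>E\<^esub> (x \<ominus>\<^bsub>E\<^esub> y)"
    have z: "?z \<in> carrier E" using xy[OF y] by simp
    have [measurable]: "max_norm Q ?z \<in> borel_measurable M" by (rule max_norm_measurable[OF Q z])
    have "measure M {\<omega> \<in> space M. max_norm Q ?z \<omega> < \<epsilon>} = measure M (S y)"
    proof (rule measure_eq_AE)
      show "AE \<omega> in M. \<omega> \<in> {\<omega> \<in> space M. max_norm Q ?z \<omega> < \<epsilon>} \<longleftrightarrow> \<omega> \<in> S y"
        using max_norm_minus[OF Q xy[OF y]] by eventually_elim (simp add: S_def N_def)
      show "{\<omega> \<in> space M. max_norm Q ?z \<omega> < \<epsilon>} \<in> sets M" by measurable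
    qed (rule Sm[OF y])
    with \<open>\<not> measure M (S y) \<le> 1 - \<delta>\<close> have "x \<oplus>\<^bsub>E\<^esub> ?z \<in> carrier E - C"
      using far[OF z] by simp
    moreover have "x \<oplus>\<^bsub>E\<^esub> ?z = y"
      using x(1) by (simp add: a_minus_def M.minus_add M.r_neg2 subsetD[OF C(1) y])
    ultimately show False using y by simp
  qed
  have directed: "\<exists>B\<in>S ` C. AE \<omega> in M. \<omega> \<in> S y \<union> S y' \<longrightarrow> \<omega> \<in> B" if y: "y \<in> C" "y' \<in> C" for y y'
  proof -
    \<comment> \<open>The indicator selects at each \<open>\<omega>\<close> whichever of
      \<open>y\<close> and \<open>y'\<close> is nearer to \<open>x\<close>, so the glued point is as
      near as the better of the two.\<close>
    define \<xi> :: "'w \<Rightarrow> real" where "\<xi> \<omega> = (if N y \<omega> \<le> N y' \<omega> then 1 else 0)" for \<omega>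
    have [measurable]: "N y \<in> borel_measurable M" "N y' \<in> borel_measurable M"
      by (simp_all add: Nm y)
    have \<xi>: "\<xi> \<in> borel_measurable M" "(\<lambda>\<omega>. 1 - \<xi> \<omega>) \<in> borel_measurable M"
      unfolding \<xi>_def by measurable
    define y'' where "y'' = real_act \<xi> y \<oplus>\<^bsub>E\<^esub> real_act (\<lambda>\<omega>. 1 - \<xi> \<omega>) y'"
    have y'': "y'' \<in> C"
      unfolding y''_def by (rule L0_convex_act[OF C(2,1) y \<xi>(1)]) (simp add: \<xi>_def)
    have eq: "x \<ominus>\<^bsub>E\<^esub> y'' = real_act \<xi> (x \<ominus>\<^bsub>E\<^esub> y) \<oplus>\<^bsub>E\<^esub> real_act (\<lambda>\<omega>. 1 - \<xi> \<omega>) (x \<ominus>\<^bsub>E\<^esub> y')"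
      unfolding y''_def by (rule minus_add_combination[OF x(1) _ _ \<xi>(1)]) (use y C in auto)
    have "AE \<omega> in M. N y'' \<omega> \<le> min (N y \<omega>) (N y' \<omega>)"
      using max_norm_add[OF Q act_closed[OF \<xi>(1) xy[OF y(1)]] act_closed[OF \<xi>(2) xy[OF y(2)]]]
        max_norm_real_act[OF Q \<xi>(1) xy[OF y(1)]] max_norm_real_act[OF Q \<xi>(2) xy[OF y(2)]]
      unfolding N_def eq
      by eventually_elim (auto simp: \<xi>_def N_def split: if_splits)
    then have "AE \<omega> in M. \<omega> \<in> S y \<union> S y' \<longrightarrow> \<omega> \<in> S y''"
      by eventually_elim (auto simp: S_def)
    with y'' show ?thesis by blast
  qed
  have "\<exists>U\<in>sets M. measure M U \<le> 1 - \<delta> \<and> (\<forall>A\<in>S ` C. AE \<omega> in M. \<omega> \<in> A \<longrightarrow> \<omega> \<in> U)"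
    by (rule directed_essential_union) (use Sm directed bound \<delta> in auto)
  then obtain U where U: "U \<in> sets M" "measure M U \<le> 1 - \<delta>"
    "\<And>y. y \<in> C \<Longrightarrow> AE \<omega> in M. \<omega> \<in> S y \<longrightarrow> \<omega> \<in> U" by auto
  \<comment> \<open>The complement of the essential union has probability at least
    \<open>\<delta>\<close>.\<close>
  have "measure M (space M - U) > 0"
    using prob_compl[OF U(1)] U(2) \<delta> by simp
  moreover have "AE \<omega> in M. \<omega> \<in> space M - U \<longrightarrow> \<epsilon> \<le> max_norm Q (x \<ominus>\<^bsub>E\<^esub> y) \<omega>" if "y \<in> C" for y
    using U(3)[OF that] by eventually_elim (auto simp: S_def N_def)
  moreover have "space M - U \<in> sets M" using U(1) by simp
  ultimately have "\<exists>B\<in>sets M. measure M B > 0 \<and>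
    (\<forall>y\<in>C. AE \<omega> in M. \<omega> \<in> B \<longrightarrow> \<epsilon> \<le> max_norm Q (x \<ominus>\<^bsub>E\<^esub> y) \<omega>)" by blast
  with Q \<epsilon> show ?thesis by blast
qed

section \<open>From dominated real functionals to the dual module\<close>

sublocale scalar_family: L0_valued_family M "L0_ring M K" "{L0_abs M}"
  by unfold_locales (use rep_L0_abs(2) in \<open>auto simp: carrier_L0_ring\<close>)

text \<open>A pointwise multiple of one finite maximum of seminorms gives continuity for the locally
  convex topology. The factor 2 leaves room for the complex case, where the modulus is estimated by
  real plus imaginary part.\<close>

lemma class_in_dual_c:
  assumes Q: "Q \<in> finite_subfamilies \<P>"
    and h: "\<And>z. z \<in> carrier E \<Longrightarrow> h z \<in> measurable M (scalars K)"
    and add: "\<And>z w. z \<in> carrier E \<Longrightarrow> w \<in> carrier E \<Longrightarrow> AE \<omega> in M. h (z \<oplus>\<^bsub>E\<^esub> w) \<omega> = h z \<omega> + h w \<omega>"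
    and smult: "\<And>\<xi> z. \<xi> \<in> L0 M (scalars K) \<Longrightarrow> z \<in> carrier E \<Longrightarrow>
      AE \<omega> in M. h (\<xi> \<odot>\<^bsub>E\<^esub> z) \<omega> = rep \<xi> \<omega> * h z \<omega>"
    and bound: "\<And>z. z \<in> carrier E \<Longrightarrow> AE \<omega> in M. cmod (h z \<omega>) \<le> 2 * max_norm Q z \<omega>"
  shows "(\<lambda>z. L0_class M (scalars K) (h z)) \<in> dual_c M K E \<P>"
proof -
  let ?R = "L0_ring M K"
  define F where "F z = L0_class M (scalars K) (h z)" for z
  have FR: "F z \<in> carrier ?R" if "z \<in> carrier E" for z
    unfolding F_def by (rule class_in_carrier[OF h[OF that]])
  have F_add: "F (z \<oplus>\<^bsub>E\<^esub> w) = F z \<oplus>\<^bsub>?R\<^esub> F w" if zw: "z \<in> carrier E" "w \<in> carrier E" for z w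
  proof -
    have "F z \<oplus>\<^bsub>?R\<^esub> F w = L0_class M (scalars K) (\<lambda>\<omega>. h z \<omega> + h w \<omega>)"
      unfolding F_def by (rule scalars.class_add[OF h h]) (use zw in auto)
    also have "\<dots> = F (z \<oplus>\<^bsub>E\<^esub> w)"
      unfolding F_def
    proof (subst L0_class_eq_iff)
      show "AE \<omega> in M. h z \<omega> + h w \<omega> = h (z \<oplus>\<^bsub>E\<^esub> w) \<omega>"
        using add[OF zw] by eventually_elim simp
    qed (use zw h in \<open>auto intro!: scalars.measurable_scalars\<close>)
    finally show ?thesis by simp
  qed
  have F_smult: "F (\<xi> \<odot>\<^bsub>E\<^esub> z) = \<xi> \<otimes>\<^bsub>?R\<^esub> F z" if \<xi>: "\<xi> \<in> carrier ?R" and z: "z \<in> carrier E" for \<xi> z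
  proof -
    have \<xi>L: "\<xi> \<in> L0 M (scalars K)" using \<xi> by (simp add: carrier_L0_ring)
    note rm = rep_measurable[OF \<xi>L]
    have "\<xi> \<otimes>\<^bsub>?R\<^esub> F z = L0_class M (scalars K) (rep \<xi>) \<otimes>\<^bsub>?R\<^esub> F z"
      by (simp add: L0_class_rep[OF \<xi>L])
    also have "\<dots> = L0_class M (scalars K) (\<lambda>\<omega>. rep \<xi> \<omega> * h z \<omega>)"
      unfolding F_def by (rule scalars.class_mult[OF rm h[OF z]])
    also have "\<dots> = F (\<xi> \<odot>\<^bsub>E\<^esub> z)"
      unfolding F_def
    proof (subst L0_class_eq_iff)
      show "AE \<omega> in M. rep \<xi> \<omega> * h z \<omega> = h (\<xi> \<odot>\<^bsub>E\<^esub> z) \<omega>"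
        using smult[OF \<xi>L z] by eventually_elim simp
    qed (use \<xi> z rm h in \<open>auto intro!: scalars.measurable_scalars\<close>)
    finally show ?thesis by simp
  qed
  have "continuous_map (L0_convex_topology M E \<P>) (L0_convex_topology M ?R {L0_abs M}) F"
    unfolding continuous_map_def topspace_L0_convex_topology scalar_family.topspace_L0_convex_topology
  proof (intro conjI allI impI)
    show "F \<in> carrier E \<rightarrow> carrier ?R" using FR by blast
    fix U assume "openin (L0_convex_topology M ?R {L0_abs M}) U"
    then have U: "\<And>a. a \<in> U \<Longrightarrow> \<exists>Q\<in>finite_subfamilies {L0_abs M}. \<exists>\<epsilon>\<in>L0_pplus M.
        \<forall>z\<in>carrier ?R. (AE \<omega> in M. max_norm Q z \<omega> \<le> rep \<epsilon> \<omega>) \<longrightarrow> a \<oplus>\<^bsub>?R\<^esub> z \<in> U"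
      unfolding scalar_family.openin_L0_convex_topology by blast
    have "\<exists>Q\<in>finite_subfamilies \<P>. \<exists>\<epsilon>\<in>L0_pplus M.
        \<forall>z\<in>carrier E. (AE \<omega> in M. max_norm Q z \<omega> \<le> rep \<epsilon> \<omega>) \<longrightarrow> x \<oplus>\<^bsub>E\<^esub> z \<in> {x \<in> carrier E. F x \<in> U}"
      if x: "x \<in> carrier E" "F x \<in> U" for x
    proof -
      obtain R \<epsilon> where R: "R \<in> finite_subfamilies {L0_abs M}" and \<epsilon>: "\<epsilon> \<in> L0_pplus M"
        and nhd: "\<And>z. z \<in> carrier ?R \<Longrightarrow> AE \<omega> in M. max_norm R z \<omega> \<le> rep \<epsilon> \<omega> \<Longrightarrow> F x \<oplus>\<^bsub>?R\<^esub> z \<in> U"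
        using U[OF x(2)] by blast
      have R_eq: "R = {L0_abs M}" using R by (auto simp: finite_subfamilies_def)
      \<comment> \<open>Halving the random radius absorbs the factor 2 in
        \<open>bound\<close>.\<close>
      define e where "e = (\<lambda>\<omega>. rep \<epsilon> \<omega> / 2)"
      have e: "e \<in> borel_measurable M"
        unfolding e_def using rep_measurable[OF L0_pplusD(1)[OF \<epsilon>]] by simp
      have "AE \<omega> in M. 0 < e \<omega>" using L0_pplusD(2)[OF \<epsilon>] by eventually_elim (simp add: e_def)
      then have eP: "L0_class M borel e \<in> L0_pplus M" by (rule L0_pplusI[OF e])
      have "x \<oplus>\<^bsub>E\<^esub> z \<in> {x \<in> carrier E. F x \<in> U}"
        if z: "z \<in> carrier E" and le: "AE \<omega> in M. max_norm Q z \<omega> \<le> rep (L0_class M borel e) \<omega>" for z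
      proof -
        have "F z \<in> L0 M (scalars K)" using FR[OF z] by (simp add: carrier_L0_ring)
        from rep_L0_abs(1)[OF this] rep_L0_class[OF h[OF z]] bound[OF z] le rep_L0_class[OF e]
        have "AE \<omega> in M. max_norm R (F z) \<omega> \<le> rep \<epsilon> \<omega>"
          unfolding R_eq max_norm_singleton F_def by eventually_elim (simp add: e_def)
        from nhd[OF FR[OF z] this] have "F (x \<oplus>\<^bsub>E\<^esub> z) \<in> U" by (simp add: F_add[OF x(1) z])
        then show ?thesis using x z by simp
      qed
      with Q eP show ?thesis by blast
    qed
    then show "openin (L0_convex_topology M E \<P>) {x \<in> carrier E. F x \<in> U}"
      unfolding openin_L0_convex_topology by blast
  qed
  with FR F_add F_smult have "F \<in> dual_c M K E \<P>"
    unfolding dual_c_def by blast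
  then show ?thesis unfolding F_def .
qed

text \<open>Domination is one-sided; using it at \<open>- z\<close> as well, where the norm has the
  same value, bounds the modulus.\<close>

lemma linear_abs_le:
  assumes f: "linear f" "dominated f (max_norm Q)" and Q: "Q \<in> finite_subfamilies \<P>" and z: "z \<in> carrier E"
  shows "AE \<omega> in M. \<bar>f z \<omega>\<bar> \<le> max_norm Q z \<omega>"
proof -
  have "AE \<omega> in M. f z \<omega> \<le> max_norm Q z \<omega>" "AE \<omega> in M. f (\<ominus>\<^bsub>E\<^esub> z) \<omega> \<le> max_norm Q (\<ominus>\<^bsub>E\<^esub> z) \<omega>"
    using f(2) z by (simp_all add: dominated_def)
  with linear_minus[OF f(1) z] max_norm_minus[OF Q z] show ?thesis by eventually_elim simp
qed

text \<open>For real \<open>K\<close> a scalar class is the class of its own real part, so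
  homogeneity over real functions is already homogeneity over all scalars.\<close>

lemma real_linear_in_dual_c:
  assumes K: "K = \<real>" and f: "linear f" "dominated f (max_norm Q)" and Q: "Q \<in> finite_subfamilies \<P>"
  shows "(\<lambda>z. L0_class M (scalars K) (\<lambda>\<omega>. complex_of_real (f z \<omega>))) \<in> dual_c M K E \<P>"
proof (rule class_in_dual_c[OF Q])
  show "(\<lambda>\<omega>. complex_of_real (f z \<omega>)) \<in> measurable M (scalars K)" if "z \<in> carrier E" for z
    by (rule scalars.measurable_scalars(1)[OF linear_measurable[OF f(1) that]])
  show "AE \<omega> in M. complex_of_real (f (z \<oplus>\<^bsub>E\<^esub> w) \<omega>) = complex_of_real (f z \<omega>) + complex_of_real (f w \<omega>)"
    if "z \<in> carrier E" "w \<in> carrier E" for z w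
    using linear_add[OF f(1) that] by eventually_elim simp
  show "AE \<omega> in M. complex_of_real (f (\<xi> \<odot>\<^bsub>E\<^esub> z) \<omega>) = rep \<xi> \<omega> * complex_of_real (f z \<omega>)"
    if \<xi>: "\<xi> \<in> L0 M (scalars K)" and z: "z \<in> carrier E" for \<xi> z
  proof -
    have m: "(\<lambda>\<omega>. Re (rep \<xi> \<omega>)) \<in> borel_measurable M" using scalars.rep_scalar(1)[OF \<xi>] by simp
    have real: "complex_of_real (Re (rep \<xi> \<omega>)) = rep \<xi> \<omega>" if "\<omega> \<in> space M" for \<omega>
      using scalars.rep_scalar(2)[OF \<xi> that] by (simp add: K)
    have "L0_class M (scalars K) (\<lambda>\<omega>. complex_of_real (Re (rep \<xi> \<omega>))) = L0_class M (scalars K) (rep \<xi>)"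
      by (subst L0_class_eq_iff[OF scalars.measurable_scalars(1)[OF m] rep_measurable[OF \<xi>]])
         (rule AE_I2, rule real)
    then have "real_act (\<lambda>\<omega>. Re (rep \<xi> \<omega>)) z = \<xi> \<odot>\<^bsub>E\<^esub> z"
      by (simp add: real_act_def L0_class_rep[OF \<xi>])
    then have "AE \<omega> in M. f (\<xi> \<odot>\<^bsub>E\<^esub> z) \<omega> = Re (rep \<xi> \<omega>) * f z \<omega>"
      using linear_act[OF f(1) z m] by simp
    moreover have "AE \<omega> in M. \<omega> \<in> space M" by simp
    ultimately show ?thesis
    proof eventually_elim
      case (elim \<omega>)
      show ?case unfolding elim(1) of_real_mult real[OF elim(2)] ..
    qed
  qed
  show "AE \<omega> in M. cmod (complex_of_real (f z \<omega>)) \<le> 2 * max_norm Q z \<omega>" if z: "z \<in> carrier E" for z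
    using linear_abs_le[OF f Q z] by eventually_elim simp
qed

abbreviation imag_unit :: "('w \<Rightarrow> complex) set" where
  "imag_unit \<equiv> L0_class M (scalars K) (\<lambda>_. \<i>)"

text \<open>The classical complexification \<open>f z - i f (i z)\<close>. Homogeneity follows by
  splitting a scalar into real and imaginary parts and using that \<open>J\<close>, multiplication
  by the imaginary unit, squares to the negative. The bound holds because \<open>J\<close> preserves
  the norm.\<close>

lemma complex_linear_in_dual_c:
  assumes K: "K = UNIV" and f: "linear f" "dominated f (max_norm Q)" and Q: "Q \<in> finite_subfamilies \<P>"
  shows "(\<lambda>z. L0_class M (scalars K) (\<lambda>\<omega>. Complex (f z \<omega>) (- f (imag_unit \<odot>\<^bsub>E\<^esub> z) \<omega>))) \<in> dual_c M K E \<P>"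
proof -
  let ?c = "L0_class M (scalars K)"
  define J where "J z = imag_unit \<odot>\<^bsub>E\<^esub> z" for z
  have im: "(\<lambda>_. \<i>) \<in> measurable M (scalars K)" by (simp add: measurable_scalars_iff K)
  have iL: "imag_unit \<in> L0 M (scalars K)" by (rule L0_class_in_L0[OF im])
  have J: "J z \<in> carrier E" if "z \<in> carrier E" for z
    unfolding J_def by (intro smult_closed class_in_carrier im that)
  have J_add: "J (z \<oplus>\<^bsub>E\<^esub> w) = J z \<oplus>\<^bsub>E\<^esub> J w" if "z \<in> carrier E" "w \<in> carrier E" for z w
    unfolding J_def by (intro smult_r_distr class_in_carrier im that)
  have cc: "?c g \<odot>\<^bsub>E\<^esub> (?c h \<odot>\<^bsub>E\<^esub> z) = ?c (\<lambda>\<omega>. g \<omega> * h \<omega>) \<odot>\<^bsub>E\<^esub> z"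
    if "g \<in> measurable M (scalars K)" "h \<in> measurable M (scalars K)" "z \<in> carrier E" for g h z
    using smult_assoc1[OF class_in_carrier[OF that(1)] class_in_carrier[OF that(2)] that(3)]
    by (simp add: scalars.class_mult[OF that(1,2)])
  have J_act: "J (real_act a z) = real_act a (J z)" if a: "a \<in> borel_measurable M" and z: "z \<in> carrier E" for a z
    unfolding J_def real_act_def
    by (simp add: cc[OF im _ z] cc[OF _ im z] scalars.measurable_scalars(1)[OF a] mult.commute)
  have J_J: "J (J z) = \<ominus>\<^bsub>E\<^esub> z" if z: "z \<in> carrier E" for z
    using act_minus_one[OF z] unfolding J_def cc[OF im im z] by (simp add: real_act_def)
  have decomp: "\<xi> \<odot>\<^bsub>E\<^esub> z = real_act (\<lambda>\<omega>. Re (rep \<xi> \<omega>)) z \<oplus>\<^bsub>E\<^esub> real_act (\<lambda>\<omega>. Im (rep \<xi> \<omega>)) (J z)"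
    if \<xi>: "\<xi> \<in> L0 M (scalars K)" and z: "z \<in> carrier E" for \<xi> z
  proof -
    let ?a = "\<lambda>\<omega>. complex_of_real (Re (rep \<xi> \<omega>))" and ?b = "\<lambda>\<omega>. complex_of_real (Im (rep \<xi> \<omega>))"
    have m: "?a \<in> measurable M (scalars K)" "?b \<in> measurable M (scalars K)"
      by (intro scalars.measurable_scalars(1); use scalars.rep_scalar(1)[OF \<xi>] in simp)+
    have bi: "(\<lambda>\<omega>. ?b \<omega> * \<i>) \<in> measurable M (scalars K)" by (rule scalars.measurable_scalars(3)[OF m(2) im])
    have "(\<lambda>\<omega>. ?a \<omega> + ?b \<omega> * \<i>) = rep \<xi>" by (auto simp: fun_eq_iff complex_eq_iff)
    then have "?c ?a \<oplus>\<^bsub>L0_ring M K\<^esub> ?c (\<lambda>\<omega>. ?b \<omega> * \<i>) = \<xi>"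
      by (simp add: scalars.class_add[OF m(1) bi] L0_class_rep[OF \<xi>])
    then have "\<xi> \<odot>\<^bsub>E\<^esub> z = ?c ?a \<odot>\<^bsub>E\<^esub> z \<oplus>\<^bsub>E\<^esub> ?c (\<lambda>\<omega>. ?b \<omega> * \<i>) \<odot>\<^bsub>E\<^esub> z"
      using smult_l_distr[OF class_in_carrier[OF m(1)] class_in_carrier[OF bi] z] by simp
    then show ?thesis by (simp add: real_act_def J_def cc[OF m(2) im z])
  qed
  have J_norm: "AE \<omega> in M. max_norm Q (J z) \<omega> = max_norm Q z \<omega>" if z: "z \<in> carrier E" for z
    using max_norm_smult[OF Q iL z] rep_L0_class[OF im] unfolding J_def by eventually_elim simp
  note f_m = linear_measurable[OF f(1)]
  have "(\<lambda>z. ?c (\<lambda>\<omega>. Complex (f z \<omega>) (- f (J z) \<omega>))) \<in> dual_c M K E \<P>"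
  proof (rule class_in_dual_c[OF Q])
    show "(\<lambda>\<omega>. Complex (f z \<omega>) (- f (J z) \<omega>)) \<in> measurable M (scalars K)" if z: "z \<in> carrier E" for z
      using f_m[OF z] f_m[OF J[OF z]] by (simp add: measurable_scalars_iff K borel_measurable_complex_iff)
    show "AE \<omega> in M. Complex (f (z \<oplus>\<^bsub>E\<^esub> w) \<omega>) (- f (J (z \<oplus>\<^bsub>E\<^esub> w)) \<omega>) =
        Complex (f z \<omega>) (- f (J z) \<omega>) + Complex (f w \<omega>) (- f (J w) \<omega>)"
      if z: "z \<in> carrier E" "w \<in> carrier E" for z w
      using linear_add[OF f(1) z] linear_add[OF f(1) J[OF z(1)] J[OF z(2)]] unfolding J_add[OF z]
      by eventually_elim (simp add: complex_eq_iff)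
    show "AE \<omega> in M. Complex (f (\<xi> \<odot>\<^bsub>E\<^esub> z) \<omega>) (- f (J (\<xi> \<odot>\<^bsub>E\<^esub> z)) \<omega>) =
        rep \<xi> \<omega> * Complex (f z \<omega>) (- f (J z) \<omega>)"
      if \<xi>: "\<xi> \<in> L0 M (scalars K)" and z: "z \<in> carrier E" for \<xi> z
    proof -
      define a b where "a = (\<lambda>\<omega>. Re (rep \<xi> \<omega>))" and "b = (\<lambda>\<omega>. Im (rep \<xi> \<omega>))"
      have a: "a \<in> borel_measurable M" and b: "b \<in> borel_measurable M"
        using scalars.rep_scalar(1)[OF \<xi>] by (simp_all add: a_def b_def)
      note Jz = J[OF z] and mz = M.a_inv_closed[OF z]
      have 1: "\<xi> \<odot>\<^bsub>E\<^esub> z = real_act a z \<oplus>\<^bsub>E\<^esub> real_act b (J z)"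
        unfolding a_def b_def by (rule decomp[OF \<xi> z])
      \<comment> \<open>Applying \<open>J\<close> to the decomposition replaces
        \<open>J (J z)\<close> by \<open>- z\<close>; this sign produces the cross terms of complex
        multiplication.\<close>
      have 2: "J (\<xi> \<odot>\<^bsub>E\<^esub> z) = real_act a (J z) \<oplus>\<^bsub>E\<^esub> real_act b (\<ominus>\<^bsub>E\<^esub> z)"
        unfolding 1 by (simp add: J_add act_closed a b z Jz J_act J_J)
      from linear_add[OF f(1) act_closed[OF a z] act_closed[OF b Jz]]
        linear_add[OF f(1) act_closed[OF a Jz] act_closed[OF b mz]]
        linear_act[OF f(1) z a] linear_act[OF f(1) Jz b] linear_act[OF f(1) Jz a] linear_act[OF f(1) mz b]
        linear_minus[OF f(1) z]
      show ?thesis unfolding 2 unfolding 1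
        by eventually_elim (simp add: complex_eq_iff a_def b_def algebra_simps)
    qed
    show "AE \<omega> in M. cmod (Complex (f z \<omega>) (- f (J z) \<omega>)) \<le> 2 * max_norm Q z \<omega>" if z: "z \<in> carrier E" for z
      using linear_abs_le[OF f Q z] linear_abs_le[OF f Q J[OF z]] J_norm[OF z]
    proof eventually_elim
      case (elim \<omega>)
      have "cmod (Complex (f z \<omega>) (- f (J z) \<omega>)) \<le> \<bar>f z \<omega>\<bar> + \<bar>f (J z) \<omega>\<bar>"
        using cmod_le[of "Complex (f z \<omega>) (- f (J z) \<omega>)"] by simp
      with elim show ?case by linarith
    qed
  qed
  then show ?thesis unfolding J_def .
qed

text \<open>Separation concerns real parts alone, and in both constructions the real part is the
  given \<open>f\<close>; from here on the two fields need no distinction.\<close>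

lemma dual_c_with_real_part:
  assumes f: "linear f" "dominated f (max_norm Q)" and Q: "Q \<in> finite_subfamilies \<P>"
  shows "\<exists>F\<in>dual_c M K E \<P>. \<forall>z\<in>carrier E. AE \<omega> in M. Re (rep (F z) \<omega>) = f z \<omega>"
proof -
  have *: "\<exists>F\<in>dual_c M K E \<P>. \<forall>z\<in>carrier E. AE \<omega> in M. Re (rep (F z) \<omega>) = f z \<omega>"
    if "(\<lambda>z. L0_class M (scalars K) (h z)) \<in> dual_c M K E \<P>"
      and h: "\<And>z. z \<in> carrier E \<Longrightarrow> h z \<in> measurable M (scalars K)" and Re: "\<And>z \<omega>. Re (h z \<omega>) = f z \<omega>" for h
  proof (rule bexI[OF _ that(1)], rule ballI)
    fix z assume "z \<in> carrier E"
    from rep_L0_class[OF h[OF this]]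
    show "AE \<omega> in M. Re (rep (L0_class M (scalars K) (h z)) \<omega>) = f z \<omega>"
      by eventually_elim (simp add: Re)
  qed
  note f_m = linear_measurable[OF f(1)]
  from scalar_field show ?thesis
  proof
    assume K: "K = \<real>"
    show ?thesis
      by (rule *[OF real_linear_in_dual_c[OF K f Q]]) (simp_all add: scalars.measurable_scalars(1) f_m)
  next
    assume K: "K = UNIV"
    have "imag_unit \<odot>\<^bsub>E\<^esub> z \<in> carrier E" if "z \<in> carrier E" for z
      by (intro smult_closed class_in_carrier that) (simp add: measurable_scalars_iff K)
    then show ?thesis
      by (intro *[OF complex_linear_in_dual_c[OF K f Q]])
         (simp_all add: measurable_scalars_iff K borel_measurable_complex_iff f_m)
  qed
qed

section \<open>Separation of a point from a closed convex set\<close>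

lemma separation:
  assumes x: "x \<in> carrier E" "x \<notin> C" and C: "C \<subseteq> carrier E" "C \<noteq> {}" "L0_convex M K E C"
    and closed: "closedin (eps_lambda_topology M E \<P>) C"
  shows "\<exists>F\<in>dual_c M K E \<P>. \<exists>B\<in>sets M. measure M B > 0 \<and>
    gt_on M B (to_bar M (L0_Re M (F x))) (\<Squnion>\<^bsub>L0_bar M\<^esub> ((\<lambda>y. to_bar M (L0_Re M (F y))) ` C)) \<and>
    eq_on M (space M - B) (to_bar M (L0_Re M (F x)))
      (\<Squnion>\<^bsub>L0_bar M\<^esub> ((\<lambda>y. to_bar M (L0_Re M (F y))) ` C))"
proof -
  obtain Q \<epsilon> B where Q: "Q \<in> finite_subfamilies \<P>" and \<epsilon>: "0 < \<epsilon>" and B: "B \<in> sets M" "measure M B > 0"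
    and far: "\<And>y. y \<in> C \<Longrightarrow> AE \<omega> in M. \<omega> \<in> B \<longrightarrow> \<epsilon> \<le> max_norm Q (x \<ominus>\<^bsub>E\<^esub> y) \<omega>"
    using distance_from_closed[OF x C(1,3) closed] by blast
  \<comment> \<open>On \<open>B\<close> this is the distance found above; off \<open>B\<close> it is
    0, which lies below the norm because norms are nonnegative. Thus \<open>d\<close> is dominated
    on all differences.\<close>
  define d where "d \<omega> = \<epsilon> * indicator B \<omega>" for \<omega>
  define D where "D = (\<lambda>y. x \<ominus>\<^bsub>E\<^esub> y) ` C"
  have xy: "x \<ominus>\<^bsub>E\<^esub> y \<in> carrier E" if "y \<in> C" for y
    using x C(1) that by auto
  have "\<exists>f. linear f \<and> dominated f (max_norm Q) \<and> (\<forall>c\<in>D. AE \<omega> in M. d \<omega> \<le> f c \<omega>)"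
  proof (rule linear_between[OF sublinear_max_norm[OF Q]])
    show "D \<noteq> {}" "D \<subseteq> carrier E" using C(2) xy by (auto simp: D_def)
    show "d \<in> borel_measurable M" unfolding d_def using B by simp
    fix c assume "c \<in> D"
    then obtain y where y: "y \<in> C" and c: "c = x \<ominus>\<^bsub>E\<^esub> y" by (auto simp: D_def)
    show "AE \<omega> in M. d \<omega> \<le> max_norm Q c \<omega>"
      using far[OF y] max_norm_nonneg[OF Q xy[OF y]] unfolding c
      by eventually_elim (auto simp: d_def indicator_def)
    fix c' \<xi> assume "c' \<in> D" and \<xi>: "\<xi> \<in> borel_measurable M" "\<And>\<omega>. 0 \<le> \<xi> \<omega> \<and> \<xi> \<omega> \<le> (1 :: real)"
    then obtain y' where y': "y' \<in> C" and c': "c' = x \<ominus>\<^bsub>E\<^esub> y'" by (auto simp: D_def)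
    have "x \<ominus>\<^bsub>E\<^esub> (real_act \<xi> y \<oplus>\<^bsub>E\<^esub> real_act (\<lambda>\<omega>. 1 - \<xi> \<omega>) y') =
        real_act \<xi> c \<oplus>\<^bsub>E\<^esub> real_act (\<lambda>\<omega>. 1 - \<xi> \<omega>) c'"
      unfolding c c' by (rule minus_add_combination[OF x(1) _ _ \<xi>(1)]) (use y y' C(1) in auto)
    with L0_convex_act[OF C(3,1) y y' \<xi>]
    show "real_act \<xi> c \<oplus>\<^bsub>E\<^esub> real_act (\<lambda>\<omega>. 1 - \<xi> \<omega>) c' \<in> D"
      unfolding D_def by (metis imageI)
  qed
  then obtain f where f: "linear f" "dominated f (max_norm Q)"
    and df: "\<And>y. y \<in> C \<Longrightarrow> AE \<omega> in M. d \<omega> \<le> f (x \<ominus>\<^bsub>E\<^esub> y) \<omega>" by (auto simp: D_def)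
  define g where "g = (\<lambda>z \<omega>. indicator B \<omega> * f z \<omega>)"
  have g: "linear g" unfolding g_def by (rule linear_indicator_mult[OF f(1) B(1)])
  \<comment> \<open>Off \<open>B\<close> the claim is nonnegativity of the norm. The cut-off
    functional keeps the same dominating norm, hence the continuity of its extension.\<close>
  have "dominated g (max_norm Q)"
    unfolding dominated_def
  proof
    fix z assume z: "z \<in> carrier E"
    then have "AE \<omega> in M. f z \<omega> \<le> max_norm Q z \<omega>" using f(2) by (simp add: dominated_def)
    with max_norm_nonneg[OF Q z] show "AE \<omega> in M. g z \<omega> \<le> max_norm Q z \<omega>"
      by eventually_elim (auto simp: g_def indicator_def)
  qed
  then obtain F where F: "F \<in> dual_c M K E \<P>" and ReF: "\<And>z. z \<in> carrier E \<Longrightarrow> AE \<omega> in M. Re (rep (F z) \<omega>) = g z \<omega>"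
    using dual_c_with_real_part[OF g _ Q] by blast
  have FL: "F z \<in> L0 M (scalars K)" if "z \<in> carrier E" for z
    using F that unfolding dual_c_def carrier_L0_ring by blast
  define r where "r z = to_bar M (L0_Re M (F z))" for z
  have Re_m: "(\<lambda>\<omega>. Re (rep (F z) \<omega>)) \<in> borel_measurable M" if "z \<in> carrier E" for z
    using scalars.rep_scalar(1)[OF FL[OF that]] by simp
  have ReL: "L0_Re M (F z) \<in> L0 M borel" if "z \<in> carrier E" for z
    unfolding L0_Re_def L0_map_def by (rule L0_class_in_L0[OF Re_m[OF that]])
  have rL: "r z \<in> L0 M borel" if "z \<in> carrier E" for z
    unfolding r_def by (rule to_bar_in_L0[OF ReL[OF that]])
  have rep_r: "AE \<omega> in M. rep (r z) \<omega> = ereal (g z \<omega>)" if z: "z \<in> carrier E" for z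
    using rep_to_bar[OF ReL[OF z]] rep_L0_class[OF Re_m[OF z]] ReF[OF z]
    unfolding r_def L0_Re_def L0_map_def by eventually_elim simp
  have A: "r ` C \<subseteq> L0 M borel" using rL C(1) by auto
  let ?S = "\<Squnion>\<^bsub>L0_bar M\<^esub> (r ` C)"
  \<comment> \<open>One bound serves both conclusions: on \<open>B\<close> it lies below
    \<open>g x\<close> by the constant \<open>\<epsilon>\<close>, and off \<open>B\<close> it equals
    \<open>g x = 0\<close>.\<close>
  have upper: "AE \<omega> in M. rep ?S \<omega> \<le> ereal (g x \<omega> - d \<omega>)"
  proof (rule Sup_least[OF A])
    show "(\<lambda>\<omega>. ereal (g x \<omega> - d \<omega>)) \<in> borel_measurable M"
      unfolding d_def using linear_measurable[OF g x(1)] B by simp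
    fix X assume "X \<in> r ` C"
    then obtain y where y: "y \<in> C" and X: "X = r y" by blast
    have yE: "y \<in> carrier E" using y C(1) by blast
    have "AE \<omega> in M. f (x \<ominus>\<^bsub>E\<^esub> y) \<omega> = f x \<omega> + f (\<ominus>\<^bsub>E\<^esub> y) \<omega>"
      unfolding a_minus_def by (rule linear_add[OF f(1) x(1)]) (use yE in simp)
    with rep_r[OF yE] df[OF y] linear_minus[OF f(1) yE]
    show "AE \<omega> in M. rep X \<omega> \<le> ereal (g x \<omega> - d \<omega>)"
      unfolding X by eventually_elim (auto simp: g_def d_def indicator_def)
  qed
  obtain y where y: "y \<in> C" using C(2) by blast
  then have yE: "y \<in> carrier E" using C(1) by blast
  \<comment> \<open>A single point of \<open>C\<close> bounds the supremum from below by
    \<open>g y\<close>, which is 0 off \<open>B\<close>; with \<open>upper\<close> this forces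
    equality there.\<close>
  have lower: "AE \<omega> in M. rep (r y) \<omega> \<le> rep ?S \<omega>"
    by (rule Sup_upper[OF A]) (use y in simp)
  have "gt_on M B (r x) ?S"
    unfolding gt_on_def using upper rep_r[OF x(1)]
  proof eventually_elim
    case (elim \<omega>)
    show ?case
    proof
      assume "\<omega> \<in> B"
      then have "ereal (g x \<omega> - d \<omega>) < rep (r x) \<omega>" using \<epsilon> elim(2) by (simp add: d_def)
      with elim(1) show "rep ?S \<omega> < rep (r x) \<omega>" by (rule le_less_trans)
    qed
  qed
  moreover have "eq_on M (space M - B) (r x) ?S"
    unfolding eq_on_def using upper lower rep_r[OF x(1)] rep_r[OF yE]
  proof eventually_elim
    case (elim \<omega>)
    then show ?case by (auto simp: g_def d_def zero_ereal_def intro: antisym)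
  qed
  ultimately have "gt_on M B (r x) ?S \<and> eq_on M (space M - B) (r x) ?S" ..
  then show ?thesis
    using F B unfolding r_def by blast
qed

end

theorem theorem4p4:
  fixes M :: "'w measure" and K :: "complex set"
    and E :: "(('w \<Rightarrow> complex) set, 'e, 'm) module_scheme"
    and \<P> :: "('e \<Rightarrow> ('w \<Rightarrow> real) set) set"
    and C :: "'e set" and x :: 'e
  assumes "random_locally_convex_module M K E \<P>"
    and "x \<in> carrier E"
    and "C \<subseteq> carrier E" and "C \<noteq> {}"
    and "closedin (eps_lambda_topology M E \<P>) C"
    and "L0_convex M K E C"
    and "x \<notin> C"
  shows "\<exists>f\<in>dual_c M K E \<P>. \<exists>B\<in>sets M. measure M B > 0 \<and>
    gt_on M B (to_bar M (L0_Re M (f x)))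
      (\<Squnion>\<^bsub>L0_bar M\<^esub> ((\<lambda>y. to_bar M (L0_Re M (f y))) ` C)) \<and>
    eq_on M (space M - B) (to_bar M (L0_Re M (f x)))
      (\<Squnion>\<^bsub>L0_bar M\<^esub> ((\<lambda>y. to_bar M (L0_Re M (f y))) ` C))"
  using assms by (intro random_locally_convex_module.separation)

end
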